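(* Let $G$ be a finitely generated group and let $T_1,T_2$ be two minimal actions of $G$ on $\mathbb{R}$-trees such that $\mathcal{C}(T_1\times T_2)\neq\emptyset$. Then $T_1$ and $T_2$ have a common refinement if and only if $\mathcal{C}(T_1\times T_2)$ is $1$-dimensional.
   Context: An $\mathbb{R}$-tree is a geodesic metric space containing no embedded topological circle; actions are isometric; $G$ acts diagonally on $T_1\times T_2$. An action is minimal if it has no proper invariant subtree. Core: a direction in $T$ based at $x\in T$ is a connected component of $T\setminus\{x\}$. A quadrant in $T_1\times T_2$ is a product $\delta_1\times\delta_2$ of a direction $\delta_1\subset T_1$ and a direction $\delta_2\subset T_2$. Fix a base point $*=( *_1,*_2)\in T_1\times T_2$ (the next notion does not depend on it). A quadrant $Q$ is heavy if there is a sequence $\gamma_k\in G$ with $\gamma_k.*\in Q$ and $d(\gamma_k.*_i,*_i)\to\infty$ for both $i=1,2$; otherwise it is light. The core $\mathcal{C}=\mathcal{C}(T_1\times T_2)$ is the complement in $T_1\times T_2$ of the union of all light quadrants. $\mathcal{C}$ is called $1$-dimensional if it contains no rectangle $I_1\times I_2$ where $I_1\subset T_1$ and $I_2\subset T_2$ are nondegenerate arcs. Refinement: a continuous map $f:T\to T'$ preserves alignment if $x\in[y,z]$ implies $f(x)\in[f(y),f(z)]$. An action of $G$ on an $\mathbb{R}$-tree $T$ is a refinement of an action of $G$ on $T'$ if there is a $G$-equivariant alignment-preserving map from $T$ onto $T'$. A common refinement of $T_1$ and $T_2$ is an action of $G$ on an $\mathbb{R}$-tree that is a refinement of both. *)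

theory Defs
  imports "HOL-Analysis.Analysis" "HOL-Algebra.Group_Action" "HOL-Algebra.Generated_Groups"
begin

section \<open>Finitely generated groups\<close>

definition finitely_generated :: "('g, 'm) monoid_scheme \<Rightarrow> bool" where
  "finitely_generated G \<longleftrightarrow>
     group G \<and> (\<exists>S. finite S \<and> S \<subseteq> carrier G \<and> generate G S = carrier G)"

section \<open>Real trees\<close>

definition geodesic :: "'a metric \<Rightarrow> 'a \<Rightarrow> 'a \<Rightarrow> (real \<Rightarrow> 'a) \<Rightarrow> bool" where
  "geodesic T x y c \<longleftrightarrow>
     c \<in> {0..mdist T x y} \<rightarrow> mspace T \<and> c 0 = x \<and> c (mdist T x y) = y \<and>
     (\<forall>s\<in>{0..mdist T x y}. \<forall>t\<in>{0..mdist T x y}. mdist T (c s) (c t) = \<bar>s - t\<bar>)"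

definition geodesic_space :: "'a metric \<Rightarrow> bool" where
  "geodesic_space T \<longleftrightarrow> (\<forall>x\<in>mspace T. \<forall>y\<in>mspace T. \<exists>c. geodesic T x y c)"

text \<open>Trees are nonempty by convention.\<close>

definition real_tree :: "'a metric \<Rightarrow> bool" where
  "real_tree T \<longleftrightarrow> mspace T \<noteq> {} \<and> geodesic_space T \<and>
     (\<nexists>f. embedding_map (top_of_set (sphere (0::complex) 1)) (mtopology_of T) f)"

text \<open>The union of all geodesics from \<open>x\<close> to \<open>y\<close>; in a real tree there is
  exactly one, and this is the segment \<open>[x,y]\<close>.\<close>

definition segment :: "'a metric \<Rightarrow> 'a \<Rightarrow> 'a \<Rightarrow> 'a set" where
  "segment T x y = (\<Union>c\<in>{c. geodesic T x y c}. c ` {0..mdist T x y})"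

definition nondegenerate_arc :: "'a metric \<Rightarrow> 'a set \<Rightarrow> bool" where
  "nondegenerate_arc T I \<longleftrightarrow>
     (\<exists>f. embedding_map (top_of_set {0..1::real}) (mtopology_of T) f \<and> I = f ` {0..1})"

definition subtree :: "'a metric \<Rightarrow> 'a set \<Rightarrow> bool" where
  "subtree T S \<longleftrightarrow> S \<subseteq> mspace T \<and> real_tree (submetric T S)"

section \<open>Isometric actions on real trees\<close>

definition tree_action ::
    "('g, 'm) monoid_scheme \<Rightarrow> 'a metric \<Rightarrow> ('g \<Rightarrow> 'a \<Rightarrow> 'a) \<Rightarrow> bool" where
  "tree_action G T \<phi> \<longleftrightarrow> real_tree T \<and> group_action G (mspace T) \<phi> \<and>
     (\<forall>g\<in>carrier G. \<forall>x\<in>mspace T. \<forall>y\<in>mspace T.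
        mdist T (\<phi> g x) (\<phi> g y) = mdist T x y)"

definition minimal_action ::
    "('g, 'm) monoid_scheme \<Rightarrow> 'a metric \<Rightarrow> ('g \<Rightarrow> 'a \<Rightarrow> 'a) \<Rightarrow> bool" where
  "minimal_action G T \<phi> \<longleftrightarrow> tree_action G T \<phi> \<and>
     \<not> (\<exists>S. subtree T S \<and> S \<noteq> mspace T \<and> (\<forall>g\<in>carrier G. \<phi> g ` S = S))"

section \<open>The core\<close>

definition directions :: "'a metric \<Rightarrow> 'a \<Rightarrow> 'a set set" where
  "directions T x =
     connected_components_of (subtopology (mtopology_of T) (mspace T - {x}))"

definition quadrants :: "'a metric \<Rightarrow> 'b metric \<Rightarrow> ('a \<times> 'b) set set" where
  "quadrants T1 T2 = {D1 \<times> D2 | D1 D2.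
     (\<exists>x\<in>mspace T1. D1 \<in> directions T1 x) \<and> (\<exists>y\<in>mspace T2. D2 \<in> directions T2 y)}"

text \<open>In the next two definitions \<open>(p1, p2)\<close> is the base point.\<close>

definition heavy ::
    "('g, 'm) monoid_scheme \<Rightarrow> 'a metric \<Rightarrow> ('g \<Rightarrow> 'a \<Rightarrow> 'a) \<Rightarrow>
     'b metric \<Rightarrow> ('g \<Rightarrow> 'b \<Rightarrow> 'b) \<Rightarrow> 'a \<Rightarrow> 'b \<Rightarrow> ('a \<times> 'b) set \<Rightarrow> bool" where
  "heavy G T1 \<phi>1 T2 \<phi>2 p1 p2 Q \<longleftrightarrow>
     (\<exists>\<gamma>::nat \<Rightarrow> 'g.
        (\<forall>k. \<gamma> k \<in> carrier G \<and> (\<phi>1 (\<gamma> k) p1, \<phi>2 (\<gamma> k) p2) \<in> Q) \<and>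
        filterlim (\<lambda>k. mdist T1 (\<phi>1 (\<gamma> k) p1) p1) at_top sequentially \<and>
        filterlim (\<lambda>k. mdist T2 (\<phi>2 (\<gamma> k) p2) p2) at_top sequentially)"

definition core ::
    "('g, 'm) monoid_scheme \<Rightarrow> 'a metric \<Rightarrow> ('g \<Rightarrow> 'a \<Rightarrow> 'a) \<Rightarrow>
     'b metric \<Rightarrow> ('g \<Rightarrow> 'b \<Rightarrow> 'b) \<Rightarrow> 'a \<Rightarrow> 'b \<Rightarrow> ('a \<times> 'b) set" where
  "core G T1 \<phi>1 T2 \<phi>2 p1 p2 =
     mspace T1 \<times> mspace T2 -
       \<Union>{Q \<in> quadrants T1 T2. \<not> heavy G T1 \<phi>1 T2 \<phi>2 p1 p2 Q}"

definition one_dimensional :: "'a metric \<Rightarrow> 'b metric \<Rightarrow> ('a \<times> 'b) set \<Rightarrow> bool" where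
  "one_dimensional T1 T2 C \<longleftrightarrow>
     \<not> (\<exists>I1 I2. nondegenerate_arc T1 I1 \<and> nondegenerate_arc T2 I2 \<and> I1 \<times> I2 \<subseteq> C)"

section \<open>Refinements\<close>

definition preserves_alignment :: "'a metric \<Rightarrow> 'b metric \<Rightarrow> ('a \<Rightarrow> 'b) \<Rightarrow> bool" where
  "preserves_alignment T T' f \<longleftrightarrow>
     continuous_map (mtopology_of T) (mtopology_of T') f \<and>
     (\<forall>x\<in>mspace T. \<forall>y\<in>mspace T. \<forall>z\<in>mspace T.
        x \<in> segment T y z \<longrightarrow> f x \<in> segment T' (f y) (f z))"

definition refinement ::
    "('g, 'm) monoid_scheme \<Rightarrow> 'a metric \<Rightarrow> ('g \<Rightarrow> 'a \<Rightarrow> 'a) \<Rightarrow>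
     'b metric \<Rightarrow> ('g \<Rightarrow> 'b \<Rightarrow> 'b) \<Rightarrow> bool" where
  "refinement G T \<phi> T' \<phi>' \<longleftrightarrow> tree_action G T \<phi> \<and> tree_action G T' \<phi>' \<and>
     (\<exists>f. preserves_alignment T T' f \<and> f ` mspace T = mspace T' \<and>
          (\<forall>g\<in>carrier G. \<forall>x\<in>mspace T. f (\<phi> g x) = \<phi>' g (f x)))"

text \<open>HOL cannot quantify existentially over types, so the type \<open>'c\<close> that contains the
  points of the common refinement is a parameter.\<close>

definition has_common_refinement ::
    "'c itself \<Rightarrow> ('g, 'm) monoid_scheme \<Rightarrow> 'a metric \<Rightarrow> ('g \<Rightarrow> 'a \<Rightarrow> 'a) \<Rightarrow>
     'b metric \<Rightarrow> ('g \<Rightarrow> 'b \<Rightarrow> 'b) \<Rightarrow> bool" where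
  "has_common_refinement _ G T1 \<phi>1 T2 \<phi>2 \<longleftrightarrow>
     (\<exists>(T::'c metric) \<phi>. refinement G T \<phi> T1 \<phi>1 \<and> refinement G T \<phi> T2 \<phi>2)"

end

theory Submission
  imports Defs
begin

text \<open>Two distinct directions \<open>A, A'\<close> at a point of \<open>T1\<close> and two distinct
  directions \<open>B, B'\<close> at a point of \<open>T2\<close> give four disjoint quadrants
  \<open>A \<times> B\<close>, \<open>A \<times> B'\<close>, \<open>A' \<times> B\<close>,
  \<open>A' \<times> B'\<close>. A subset of \<open>T1 \<times> T2\<close>
  \<^emph>\<open>crosses\<close> if it meets all four quadrants of some such configuration.
  Crossing is the obstruction on both sides of the equivalence.

From a refinement to dimension one. Let \<open>f1, f2\<close> be the maps from a common
  refinement \<open>T\<close>, and suppose that the core contains a rectangle. The four quadrants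
  around a point in the middle of the rectangle contain its four corners, so they are heavy, and
  since heaviness does not depend on the base point, each of them contains a translate of
  \<open>(f1 t, f2 t)\<close> for a fixed \<open>t\<close> in \<open>T\<close>
  (\<open>heavy_point_of_any_orbit\<close>). So the image of \<open>T\<close> crosses, as
  witnessed by four points of \<open>T\<close>. In a tree, a closed quadrilateral has a pair of
  opposite sides that meet (\<open>four_points_segments_meet\<close>). Since \<open>f1\<close> and
  \<open>f2\<close> preserve alignment, one of them sends the common point into two disjoint
  directions, which is absurd (\<open>one_dimensional_of_refinement\<close>).

From dimension one to a refinement. If the core crosses, then the bridges between the opposite
  directions span a rectangle, and it lies in the core: a quadrant around a point of this
  rectangle always contains one of the four given points of the core
  (\<open>core_not_crosses\<close>). So a core of dimension one is noncrossing. On a noncrossing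
  set the metric \<open>d1 + d2\<close> satisfies the four-point condition that characterises
  trees, because each of \<open>d1\<close> and \<open>d2\<close> satisfies it, and their sum can
  violate it only if they split four points into pairs in different ways, which is a crossing
  (\<open>four_point_sum_metric\<close>). The core need not be connected, though. Zorn's lemma
  gives a maximal invariant noncrossing set \<open>X\<close> that contains it. Two ways of
  enlarging a noncrossing set equivariantly create no crossing: adding every point whose quadrants
  all meet the set (\<open>quadrant_hull\<close>), and then adding the midpoints of all pairs of
  points with nothing of the set between them (\<open>crosses_fill_gaps\<close>). Hence
  \<open>X\<close> is closed, contains medians, and has no gaps, and any two points of
  \<open>X\<close> are joined in \<open>X\<close> by a path that is monotone in both coordinates.
  This path is a geodesic for \<open>d1 + d2\<close>, so \<open>X\<close> is a real tree. The two
  projections preserve alignment, and they are onto by minimality because their images are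
  invariant subtrees.

Real trees enter through a metric description: they are the nonempty geodesic spaces with the
  four-point condition (\<open>real_tree_imp_four_point\<close>,
  \<open>rtree_imp_real_tree\<close>), and the direction of \<open>u\<close> at \<open>x\<close>
  consists of the points \<open>v\<close> with \<open>x\<close> not in \<open>[u,v]\<close>
  (\<open>directions_eq_sides\<close>). After this, statements about segments, medians and
  directions become linear arithmetic with distances.\<close>

section \<open>Geodesics and metric betweenness\<close>

lemma mdist_self [simp]: "x \<in> mspace T \<Longrightarrow> mdist T x x = 0"
  by simp

text \<open>Membership in the metric interval from \<open>u\<close> to \<open>v\<close>. In a geodesic space
  this is the segment (\<open>segment_eq_btw\<close>), but it avoids any choice of a geodesic.\<close>

definition btw :: "'a metric \<Rightarrow> 'a \<Rightarrow> 'a \<Rightarrow> 'a \<Rightarrow> bool" where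
  "btw T u x v \<longleftrightarrow> x \<in> mspace T \<and> mdist T u x + mdist T x v = mdist T u v"

lemma btw_commute: "btw T u x v \<longleftrightarrow> btw T v x u"
  by (auto simp: btw_def mdist_commute[of T] add.commute)

lemma btw_ends [simp]:
  assumes "u \<in> mspace T" "v \<in> mspace T"
  shows "btw T u u v" "btw T u v v"
  using assms by (auto simp: btw_def)

lemma btw_mspace: "btw T u x v \<Longrightarrow> x \<in> mspace T"
  by (simp add: btw_def)

lemma btw_le:
  assumes "btw T u x v"
  shows "mdist T u x \<le> mdist T u v" "mdist T x v \<le> mdist T u v"
  using assms mdist_nonneg[of T x v] mdist_nonneg[of T u x] unfolding btw_def by linarith+

lemma btw_self:
  assumes "u \<in> mspace T" "btw T u x u"
  shows "x = u"
proof -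
  have "mdist T u u = 0" using assms(1) by simp
  moreover have "mdist T u x + mdist T u x = mdist T u u"
    using assms by (simp add: btw_def mdist_commute[of T x u])
  ultimately have "mdist T u x = 0" by linarith
  then show ?thesis using assms by (auto simp: btw_def)
qed

lemma btw_trans:
  assumes "u \<in> mspace T" "v \<in> mspace T" "btw T u x v" "btw T u y x"
  shows "btw T u y v" "btw T y x v"
proof -
  have "mdist T y v \<le> mdist T y x + mdist T x v" "mdist T u v \<le> mdist T u y + mdist T y v"
    using assms by (auto simp: btw_def intro!: mdist_triangle)
  then show "btw T u y v" "btw T y x v"
    using assms by (auto simp: btw_def)
qed

lemma btw_trans':
  assumes "u \<in> mspace T" "v \<in> mspace T" "btw T u x v" "btw T x y v"
  shows "btw T u y v" "btw T u x y"
  using btw_trans[of v T u x y] assms by (auto simp: btw_commute)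

lemma geodesicD:
  assumes "geodesic T x y c"
  shows "c 0 = x" "c (mdist T x y) = y"
    "\<And>s. 0 \<le> s \<Longrightarrow> s \<le> mdist T x y \<Longrightarrow> c s \<in> mspace T"
    "\<And>s t. 0 \<le> s \<Longrightarrow> s \<le> mdist T x y \<Longrightarrow> 0 \<le> t \<Longrightarrow> t \<le> mdist T x y \<Longrightarrow>
        mdist T (c s) (c t) = \<bar>s - t\<bar>"
  using assms by (auto simp: geodesic_def)

lemma geodesic_btw:
  assumes "geodesic T x y c" "0 \<le> s" "s \<le> mdist T x y"
  shows "btw T x (c s) y" "mdist T x (c s) = s" "mdist T (c s) y = mdist T x y - s"
proof -
  have "mdist T x (c s) = s" "mdist T (c s) y = mdist T x y - s"
    using geodesicD(4)[OF assms(1), of 0 s] geodesicD(4)[OF assms(1), of s "mdist T x y"] assms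
      geodesicD(1,2)[OF assms(1)] by auto
  then show "btw T x (c s) y" "mdist T x (c s) = s" "mdist T (c s) y = mdist T x y - s"
    using geodesicD(3)[OF assms] by (auto simp: btw_def)
qed

lemma geodesic_inj:
  assumes "geodesic T x y c" "0 \<le> s" "s \<le> mdist T x y" "0 \<le> t" "t \<le> mdist T x y" "c s = c t"
  shows "s = t"
  using geodesic_btw(2)[OF assms(1-3)] geodesic_btw(2)[OF assms(1,4,5)] unfolding assms(6) by linarith

lemma geodesic_concat:
  assumes "geodesic T u x c" "geodesic T x v c'" "btw T u x v"
    and "u \<in> mspace T" "v \<in> mspace T"
  shows "geodesic T u v (\<lambda>t. if t \<le> mdist T u x then c t else c' (t - mdist T u x))"
    (is "geodesic T u v ?f")
proof -
  define a b where "a = mdist T u x" and "b = mdist T x v"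
  have ab: "mdist T u v = a + b" "a \<ge> 0" "b \<ge> 0" and x: "x \<in> mspace T"
    using assms by (auto simp: btw_def a_def b_def)
  note c = geodesicD[OF assms(1), folded a_def] geodesic_btw[OF assms(1), folded a_def]
  note c' = geodesicD[OF assms(2), folded b_def] geodesic_btw[OF assms(2), folded b_def]
  have mem: "?f t \<in> mspace T" if "0 \<le> t" "t \<le> a + b" for t
    using that c(3) c'(3)[of "t - a"] by (auto simp: a_def)
  have mix: "mdist T (?f s) (?f t) = t - s" if "0 \<le> s" "s \<le> a" "a < t" "t \<le> a + b" for s t
  proof -
    have 1: "mdist T (c s) x = a - s" "mdist T x (c' (t - a)) = t - a"
      "mdist T u (c s) = s" "mdist T (c' (t - a)) v = b - (t - a)"
      using c(6)[of s] c(7)[of s] c'(6)[of "t - a"] c'(7)[of "t - a"] that by auto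
    have m: "c s \<in> mspace T" "c' (t - a) \<in> mspace T" using c(3) c'(3)[of "t - a"] that by auto
    have "mdist T (c s) (c' (t - a)) \<le> mdist T (c s) x + mdist T x (c' (t - a))"
      by (intro mdist_triangle m x)
    moreover have "mdist T u v \<le> mdist T u (c s) + mdist T (c s) v"
      by (intro mdist_triangle m assms)
    moreover have "mdist T (c s) v \<le> mdist T (c s) (c' (t - a)) + mdist T (c' (t - a)) v"
      by (intro mdist_triangle m assms)
    ultimately have "mdist T (c s) (c' (t - a)) = t - s"
      using 1 ab by linarith
    then show ?thesis using that by (auto simp: a_def)
  qed
  have iso: "mdist T (?f s) (?f t) = \<bar>s - t\<bar>" if "0 \<le> s" "s \<le> a + b" "0 \<le> t" "t \<le> a + b" for s t
  proof -
    consider "s \<le> a" "t \<le> a" | "s \<le> a" "a < t" | "a < s" "t \<le> a" | "a < s" "a < t" by linarith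
    then show ?thesis
    proof cases
      case 1 then show ?thesis using c(4)[of s t] that by (auto simp: a_def)
    next
      case 2 then show ?thesis using mix[of s t] that by auto
    next
      case 3 then show ?thesis using mix[of t s] that by (auto simp: mdist_commute)
    next
      case 4 then show ?thesis using c'(4)[of "s-a" "t-a"] that by (auto simp: a_def)
    qed
  qed
  have "?f 0 = u" using c(1) ab by (auto simp: a_def)
  moreover have "?f (a + b) = v"
  proof (cases "b = 0")
    case True
    then have "x = v" using x assms(5) by (auto simp: b_def)
    then show ?thesis using c(2) True by (auto simp: a_def)
  next
    case False
    then show ?thesis using c'(2) ab by (auto simp: a_def)
  qed
  ultimately show ?thesis
    unfolding geodesic_def ab(1) using mem iso by (auto simp: a_def)
qed

lemma geodesic_part:
  assumes c: "geodesic T u v c" and s: "0 \<le> s" "s \<le> t" "t \<le> mdist T u v"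
  shows "geodesic T (c s) (c t) (\<lambda>r. c (s + r))"
proof -
  have "mdist T (c s) (c t) = t - s"
    using geodesicD(4)[OF c, of s t] s by auto
  then show ?thesis
    using s geodesicD(3,4)[OF c] by (auto simp: geodesic_def)
qed

lemma geodesic_rev:
  assumes c: "geodesic T u v c"
  shows "geodesic T v u (\<lambda>r. c (mdist T u v - r))"
  using geodesicD[OF c] by (auto simp: geodesic_def mdist_commute[of T v u])

lemma geodesic_through:
  assumes "geodesic_space T" "u \<in> mspace T" "v \<in> mspace T" "btw T u x v"
  obtains c where "geodesic T u v c" "c (mdist T u x) = x"
proof -
  have x: "x \<in> mspace T" using assms by (simp add: btw_def)
  obtain c c' where cc: "geodesic T u x c" "geodesic T x v c'"
    using assms x unfolding geodesic_space_def by blast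
  show ?thesis
    by (rule that[OF geodesic_concat[OF cc assms(4,2,3)]]) (simp add: geodesicD(2)[OF cc(1)])
qed

lemma segment_eq_btw:
  assumes "geodesic_space T" "u \<in> mspace T" "v \<in> mspace T"
  shows "segment T u v = {x. btw T u x v}"
proof (intro equalityI subsetI)
  fix x assume "x \<in> segment T u v"
  then obtain c t where "geodesic T u v c" "0 \<le> t" "t \<le> mdist T u v" "x = c t"
    unfolding segment_def by fastforce
  then show "x \<in> {x. btw T u x v}" using geodesic_btw(1)[of T u v c t] by simp
next
  fix x assume "x \<in> {x. btw T u x v}"
  then have b: "btw T u x v" by simp
  obtain c where c: "geodesic T u v c" "c (mdist T u x) = x"
    using geodesic_through[OF assms b] .
  have "mdist T u x \<le> mdist T u v" by (rule btw_le[OF b])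
  then have "x \<in> c ` {0..mdist T u v}" by (intro image_eqI[of _ _ "mdist T u x"]) (auto simp: c(2))
  then show "x \<in> segment T u v" using c(1) by (auto simp: segment_def)
qed

lemma geodesic_space_point:
  assumes "geodesic_space T" "u \<in> mspace T" "v \<in> mspace T" "0 \<le> t" "t \<le> mdist T u v"
  obtains x where "btw T u x v" "mdist T u x = t" "mdist T x v = mdist T u v - t"
proof -
  obtain c where "geodesic T u v c" using assms unfolding geodesic_space_def by blast
  from geodesic_btw[OF this assms(4,5)] show ?thesis using that by blast
qed

lemma Lipschitz_real_continuous_map:
  assumes "\<And>s. s \<in> S \<Longrightarrow> f s \<in> mspace T"
    and "\<And>s t. s \<in> S \<Longrightarrow> t \<in> S \<Longrightarrow> s \<le> t \<Longrightarrow> mdist T (f s) (f t) \<le> k * (t - s)"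
  shows "continuous_map (top_of_set (S::real set)) (mtopology_of T) f"
proof -
  have "Lipschitz_continuous_map (submetric euclidean_metric S) T f"
    unfolding Lipschitz_continuous_map_def
  proof (intro conjI exI ballI)
    fix s t assume "s \<in> mspace (submetric euclidean_metric S)" "t \<in> mspace (submetric euclidean_metric S)"
    then have st: "s \<in> S" "t \<in> S" by auto
    show "mdist T (f s) (f t) \<le> k * mdist (submetric euclidean_metric S) s t"
      using assms(2)[OF st] assms(2)[OF st(2) st(1)]
      by (cases "s \<le> t") (auto simp: dist_real_def mdist_commute[of T "f s" "f t"])
  qed (use assms in auto)
  then show ?thesis
    using Lipschitz_continuous_imp_continuous_map mtopology_of_submetric
      mtopology_of_euclidean by metis
qed

lemma geodesic_continuous:
  assumes "geodesic T u v c"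
  shows "continuous_map (top_of_set {0..mdist T u v}) (mtopology_of T) c"
  by (rule Lipschitz_real_continuous_map[of _ _ _ 1]) (use geodesicD(3,4)[OF assms] in auto)

lemma Hausdorff_mtopology_of: "Hausdorff_space (mtopology_of T)"
  by (simp add: mtopology_of_def Metric_space.Hausdorff_space_mtopology)

text \<open>The exponential map presents the circle as a quotient of an interval, so an injective loop
  factors through it, and a continuous injection of the compact circle into a Hausdorff space is
  an embedding.\<close>

lemma loop_imp_embedded_circle:
  fixes f :: "real \<Rightarrow> 'a"
  assumes L: "L > 0"
    and cont: "continuous_map (top_of_set {0..L}) (mtopology_of T) f"
    and inj: "inj_on f {0..<L}" and loop: "f 0 = f L"
  shows "\<exists>g. embedding_map (top_of_set (sphere (0::complex) 1)) (mtopology_of T) g"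
proof -
  define e where "e t = cis (2 * pi * t / L)" for t
  define g where "g z = f (L * (Arg2pi z / (2 * pi)))" for z
  have ge: "g (e t) = f t" if "0 \<le> t" "t \<le> L" for t
  proof (cases "t = L")
    case True
    then show ?thesis using L loop by (simp add: g_def e_def Arg2pi_of_real[of 1, simplified])
  next
    case False
    then have "Arg2pi (e t) = 2 * pi * t / L"
      using that L by (intro Arg2pi_unique[of 1]) (auto simp: e_def cis_conv_exp field_simps)
    then show ?thesis using L by (simp add: g_def)
  qed
  have e_sphere: "e ` {0..L} = sphere 0 1"
  proof (intro equalityI subsetI)
    fix z assume "z \<in> sphere (0::complex) 1"
    then have n: "norm z = 1" by simp
    then have "z = cis (Arg2pi z)"
      using Arg2pi_eq[of z] by (simp add: cis_conv_exp)
    also have "\<dots> = e (L * (Arg2pi z / (2 * pi)))" using L by (simp add: e_def)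
    finally have "z = e (L * (Arg2pi z / (2 * pi)))" .
    moreover have "L * (Arg2pi z / (2 * pi)) \<in> {0..L}"
      using Arg2pi_ge_0[of z] Arg2pi_lt_2pi[of z] L
      by (auto simp: field_simps)
    ultimately show "z \<in> e ` {0..L}" by blast
  qed (auto simp: e_def)
  have ce: "continuous_map (top_of_set {0..L}) (top_of_set (sphere 0 1)) e"
  proof -
    have "continuous_on {0..L} e"
      unfolding e_def using L by (intro continuous_intros) auto
    then show ?thesis using e_sphere by (auto simp: continuous_map_in_subtopology)
  qed
  have qe: "quotient_map (top_of_set {0..L}) (top_of_set (sphere 0 1)) e"
  proof (rule continuous_closed_imp_quotient_map[OF ce])
    show "closed_map (top_of_set {0..L}) (top_of_set (sphere 0 1)) e"
    proof (rule continuous_imp_closed_map[OF ce])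
      show "compact_space (top_of_set {0..L})"
        by (simp add: compact_space_subtopology)
      show "Hausdorff_space (top_of_set (sphere (0::complex) 1))"
        by (simp add: Hausdorff_space_subtopology)
    qed
  qed (use e_sphere in auto)
  have "continuous_map (top_of_set {0..L}) (mtopology_of T) (g \<circ> e)"
    by (rule continuous_map_eq[OF cont]) (simp add: ge)
  then have cg: "continuous_map (top_of_set (sphere 0 1)) (mtopology_of T) g"
    using continuous_compose_quotient_map[OF qe] by blast
  have "inj_on g (sphere 0 1)"
  proof (rule inj_onI)
    fix z w assume zw: "z \<in> sphere (0::complex) 1" "w \<in> sphere (0::complex) 1" "g z = g w"
    have *: "L * (Arg2pi z / (2 * pi)) \<in> {0..<L}" for z
      using Arg2pi_ge_0[of z] Arg2pi_lt_2pi[of z] L by (auto simp: field_simps)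
    have "L * (Arg2pi z / (2 * pi)) = L * (Arg2pi w / (2 * pi))"
      using inj_onD[OF inj _ *[of z] *[of w]] zw(3) by (simp add: g_def)
    then have "Arg2pi z = Arg2pi w" using L by simp
    then show "z = w" using zw Arg2pi_eq[of z] Arg2pi_eq[of w] by (metis mem_sphere_0)
  qed
  then have "embedding_map (top_of_set (sphere (0::complex) 1)) (mtopology_of T) g"
    by (intro continuous_imp_embedding_map cg Hausdorff_mtopology_of)
      (simp_all add: compact_space_subtopology)
  then show ?thesis by blast
qed

section \<open>Spaces without embedded circles satisfy the four-point condition\<close>

text \<open>Running around the triangle is a \<open>1\<close>-Lipschitz loop; it is injective because the
  sides meet only at their common vertices.\<close>

lemma geodesic_triangle_imp_embedded_circle:
  assumes g1: "geodesic T a b c1" and g2: "geodesic T b c c2" and g3: "geodesic T c a c3"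
    and abc: "a \<in> mspace T" "b \<in> mspace T" "c \<in> mspace T" "a \<noteq> b" "b \<noteq> c" "c \<noteq> a"
    and i1: "\<And>s t. s \<in> {0..mdist T a b} \<Longrightarrow> t \<in> {0..mdist T b c} \<Longrightarrow> c1 s = c2 t \<Longrightarrow> c1 s = b"
    and i2: "\<And>s t. s \<in> {0..mdist T b c} \<Longrightarrow> t \<in> {0..mdist T c a} \<Longrightarrow> c2 s = c3 t \<Longrightarrow> c2 s = c"
    and i3: "\<And>s t. s \<in> {0..mdist T a b} \<Longrightarrow> t \<in> {0..mdist T c a} \<Longrightarrow> c1 s = c3 t \<Longrightarrow> c1 s = a"
  shows "\<exists>g. embedding_map (top_of_set (sphere (0::complex) 1)) (mtopology_of T) g"
proof -
  define p where "p = mdist T a b"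
  define q where "q = mdist T b c"
  define r where "r = mdist T c a"
  have "p \<noteq> 0" "q \<noteq> 0" "r \<noteq> 0" using abc by (simp_all add: p_def q_def r_def)
  moreover have "p \<ge> 0" "q \<ge> 0" "r \<ge> 0" by (simp_all add: p_def q_def r_def)
  ultimately have pos: "p > 0" "q > 0" "r > 0" by linarith+
  note G1 = geodesicD[OF g1, folded p_def] geodesic_btw[OF g1, folded p_def]
  note G2 = geodesicD[OF g2, folded q_def] geodesic_btw[OF g2, folded q_def]
  note G3 = geodesicD[OF g3, folded r_def] geodesic_btw[OF g3, folded r_def]
  define f where "f t = (if t \<le> p then c1 t else if t \<le> p + q then c2 (t - p) else c3 (t - p - q))" for t
  have f1: "f t = c1 t" if "t \<le> p" for t using that by (simp add: f_def)
  have f2: "f t = c2 (t - p)" if "p < t" "t \<le> p + q" for t using that by (simp add: f_def)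
  have f3: "f t = c3 (t - p - q)" if "p + q < t" for t using that pos by (simp add: f_def)
  have mem: "f t \<in> mspace T" if "0 \<le> t" "t \<le> p + q + r" for t
    using that G1(3)[of t] G2(3)[of "t - p"] G3(3)[of "t - p - q"] pos by (auto simp: f_def)
  have from_a: "mdist T (f s) b = p - s" if "0 \<le> s" "s \<le> p" for s
    using G1(7)[of s] that by (simp add: f1)
  have to_b: "mdist T b (f t) = t - p" if "p < t" "t \<le> p + q" for t
    using G2(6)[of "t - p"] that by (simp add: f2)
  have from_b: "mdist T (f s) c = q - (s - p)" if "p < s" "s \<le> p + q" for s
    using G2(7)[of "s - p"] that by (simp add: f2)
  have to_c: "mdist T c (f t) = t - p - q" if "p + q < t" "t \<le> p + q + r" for t
    using G3(6)[of "t - p - q"] that by (simp add: f3)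
  have lip: "mdist T (f s) (f t) \<le> 1 * (t - s)" if st: "s \<in> {0..p + q + r}" "t \<in> {0..p + q + r}" "s \<le> t" for s t
  proof -
    have m: "f s \<in> mspace T" "f t \<in> mspace T" using mem that by auto
    note tri = mdist_triangle[OF m(1) abc(2) m(2)] mdist_triangle[OF m(1) abc(3) m(2)]
      mdist_triangle[OF m(1) abc(2) abc(3)]
    consider "t \<le> p" | "s \<le> p" "p < t" "t \<le> p + q" | "s \<le> p" "p + q < t"
      | "p < s" "t \<le> p + q" | "p < s" "s \<le> p + q" "p + q < t" | "p + q < s"
      using \<open>s \<le> t\<close> pos by linarith
    then show ?thesis
    proof cases
      case 1
      then show ?thesis using G1(4)[of s t] that by (simp add: f1)
    next
      case 2
      then show ?thesis using tri from_a[of s] to_b[of t] that by simp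
    next
      case 3
      then have "mdist T (f s) b = p - s" "mdist T c (f t) = t - p - q"
        using from_a[of s] to_c[of t] that by auto
      then show ?thesis using tri by (simp add: q_def[symmetric])
    next
      case 4
      then show ?thesis using G2(4)[of "s-p" "t-p"] that by (simp add: f2)
    next
      case 5
      then show ?thesis using tri from_b[of s] to_c[of t] that by simp
    next
      case 6
      then show ?thesis using G3(4)[of "s-p-q" "t-p-q"] that by (simp add: f3)
    qed
  qed
  have inj: "s = t" if "0 \<le> s" "s \<le> t" "t < p + q + r" "f s = f t" for s t
  proof -
    consider "t \<le> p" | "s \<le> p" "p < t" "t \<le> p + q" | "s \<le> p" "p + q < t"
      | "p < s" "t \<le> p + q" | "p < s" "s \<le> p + q" "p + q < t" | "p + q < s"
      using \<open>s \<le> t\<close> pos by linarith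
    then show ?thesis
    proof cases
      case 1
      then have "c1 s = c1 t" using that(2,4) by (simp add: f1)
      then show ?thesis using 1 that(1,2) by (intro geodesic_inj[OF g1]) (simp_all add: p_def)
    next
      case 2
      then have "f t = b" using i1[of s "t - p"] that by (simp add: f1 f2 p_def q_def)
      then show ?thesis using to_b[of t] 2 abc by simp
    next
      case 3
      then have "f t = a" using i3[of s "t - p - q"] that pos by (simp add: f1 f3 p_def r_def)
      then show ?thesis using to_c[of t] 3 that by (simp add: r_def)
    next
      case 4
      then have "c2 (s - p) = c2 (t - p)" using that(2,4) by (simp add: f2)
      then have "s - p = t - p" using 4 that(1,2) by (intro geodesic_inj[OF g2]) (simp_all add: q_def)
      then show ?thesis by simp
    next
      case 5
      then have "f t = c" using i2[of "s - p" "t - p - q"] that by (simp add: f2 f3 q_def r_def)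
      then show ?thesis using to_c[of t] 5 that abc by simp
    next
      case 6
      then have "c3 (s - p - q) = c3 (t - p - q)" using that(2,4) by (simp add: f3)
      then have "s - p - q = t - p - q"
        using 6 that(1-3) by (intro geodesic_inj[OF g3]) (simp_all add: r_def)
      then show ?thesis by simp
    qed
  qed
  have "inj_on f {0..<p + q + r}"
  proof (rule inj_onI)
    fix s t assume "s \<in> {0..<p + q + r}" "t \<in> {0..<p + q + r}" "f s = f t"
    then show "s = t" using inj[of s t] inj[of t s] by (cases "s \<le> t") auto
  qed
  moreover have "f 0 = f (p + q + r)"
    using pos G1(1) G3(2) by (simp add: f1 f3)
  moreover have "continuous_map (top_of_set {0..p + q + r}) (mtopology_of T) f"
    by (rule Lipschitz_real_continuous_map[of _ f T 1, OF _ lip]) (use mem in auto)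
  ultimately show ?thesis
    using loop_imp_embedded_circle[of "p + q + r" T f] pos by auto
qed

text \<open>Also known as \<open>0\<close>-hyperbolicity: among the three sums of distances that belong to
  the three ways of splitting four points into pairs, the largest two are equal.\<close>

definition four_point :: "'a metric \<Rightarrow> bool" where
  "four_point T \<longleftrightarrow> (\<forall>x\<in>mspace T. \<forall>y\<in>mspace T. \<forall>z\<in>mspace T. \<forall>w\<in>mspace T.
     mdist T x y + mdist T z w \<le> max (mdist T x z + mdist T y w) (mdist T x w + mdist T y z))"

text \<open>If two geodesics \<open>c, c'\<close> from \<open>u\<close> to \<open>v\<close> differ at time
  \<open>h\<close>, let \<open>[s,s']\<close> be the closure of the maximal interval of
  disagreement around \<open>h\<close>. A point common to both geodesics is passed at the same
  time, namely its distance from \<open>u\<close>, so the two arcs from \<open>c s\<close> to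
  \<open>c s'\<close> are disjoint in between and form a circle. The point \<open>c h\<close>
  subdivides one of them so that the circle is a triangle of geodesics.\<close>

lemma no_circle_btw_unique:
  assumes geo: "geodesic_space T"
    and nc: "\<nexists>g. embedding_map (top_of_set (sphere (0::complex) 1)) (mtopology_of T) g"
    and uv: "u \<in> mspace T" "v \<in> mspace T"
    and x: "btw T u x v" and y: "btw T u y v" and eq: "mdist T u x = mdist T u y"
  shows "x = y"
proof (rule ccontr)
  assume ne: "x \<noteq> y"
  define L where "L = mdist T u v"
  define h where "h = mdist T u x"
  obtain c where c: "geodesic T u v c" and cx: "c h = x"
    using geodesic_through[OF geo uv x] h_def by metis
  obtain c' where c': "geodesic T u v c'" and cy: "c' h = y"
    using geodesic_through[OF geo uv y] h_def eq by metis
  note C = geodesicD[OF c, folded L_def] geodesic_btw[OF c, folded L_def]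
  note C' = geodesicD[OF c', folded L_def] geodesic_btw[OF c', folded L_def]
  have h: "0 \<le> h" "h \<le> L" using btw_le[OF x] by (auto simp: h_def L_def)
  define \<delta> where "\<delta> t = mdist T (c t) (c' t)" for t
  have d0: "\<delta> t = 0 \<longleftrightarrow> c t = c' t" if "0 \<le> t" "t \<le> L" for t
    using that C(3) C'(3) by (simp add: \<delta>_def)
  have lip: "\<bar>\<delta> s - \<delta> t\<bar> \<le> 2 * \<bar>s - t\<bar>" if st: "0 \<le> s" "s \<le> L" "0 \<le> t" "t \<le> L" for s t
  proof -
    have m: "c s \<in> mspace T" "c t \<in> mspace T" "c' s \<in> mspace T" "c' t \<in> mspace T"
      using st C(3) C'(3) by auto
    define k where "k = \<bar>s - t\<bar>"
    have e: "mdist T (c s) (c t) = k" "mdist T (c' s) (c' t) = k"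
      using C(4)[OF st] C'(4)[OF st] by (simp_all add: k_def)
    have "\<delta> s - \<delta> t \<le> 2 * k"
      unfolding \<delta>_def using mdist_triangle[OF m(1) m(2) m(3)] mdist_triangle[OF m(2) m(4) m(3)] e
        mdist_commute[of T "c' t" "c' s"] by linarith
    moreover have "\<delta> t - \<delta> s \<le> 2 * k"
      unfolding \<delta>_def using mdist_triangle[OF m(2) m(1) m(4)] mdist_triangle[OF m(1) m(3) m(4)] e
        mdist_commute[of T "c t" "c s"] by linarith
    ultimately show ?thesis unfolding k_def by linarith
  qed
  have cont: "continuous_on {0..L} \<delta>"
    by (rule lipschitz_on_continuous_on[of 2], rule lipschitz_onI) (use lip in \<open>auto simp: dist_real_def\<close>)
  define E where "E = {t \<in> {0..L}. \<delta> t = 0}"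
  have "closed E"
    unfolding E_def using continuous_closed_preimage_constant[OF cont, of 0] by simp
  then have comp: "compact (E \<inter> {0..h})" "compact (E \<inter> {h..L})"
    by (auto intro: closed_Int_compact)
  have "0 \<in> E" "L \<in> E"
    using h C(1,2) C'(1,2) d0[of 0] d0[of L] by (auto simp: E_def)
  then have ne0: "E \<inter> {0..h} \<noteq> {}" "E \<inter> {h..L} \<noteq> {}" using h by auto
  obtain s where s: "s \<in> E" "0 \<le> s" "s \<le> h" "\<And>t. t \<in> E \<Longrightarrow> 0 \<le> t \<Longrightarrow> t \<le> h \<Longrightarrow> t \<le> s"
    using compact_attains_sup[OF comp(1) ne0(1)] by auto
  obtain s' where s': "s' \<in> E" "h \<le> s'" "s' \<le> L" "\<And>t. t \<in> E \<Longrightarrow> h \<le> t \<Longrightarrow> t \<le> L \<Longrightarrow> s' \<le> t"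
    using compact_attains_inf[OF comp(2) ne0(2)] by auto
  have nh: "h \<notin> E" using ne d0[of h] h cx cy by (auto simp: E_def)
  then have lt: "s < h" "h < s'" using s s' by (auto simp: order.order_iff_strict)
  have noE: "t = s \<or> t = s'" if "t \<in> E" "s \<le> t" "t \<le> s'" for t
    using s(4)[of t] s'(4)[of t] that h s(2) s'(3) by (cases "t \<le> h") auto
  have same: "c s = c' s" "c s' = c' s'" using s(1) s'(1) d0 by (auto simp: E_def)
  have dd: "mdist T (c s) (c h) = h - s" "mdist T (c h) (c s') = s' - h" "mdist T (c' s') (c' s) = s' - s"
    using C(4)[of s h] C(4)[of h s'] C'(4)[of s' s] s(2) s'(3) lt h by auto
  have meet: "i = j" if "0 \<le> i" "i \<le> L" "0 \<le> j" "j \<le> L" "c i = c' j" for i j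
    using C(6)[OF that(1,2)] C'(6)[OF that(3,4)] that(5) by simp
  have g1: "geodesic T (c s) (c h) (\<lambda>r. c (s + r))" and g2: "geodesic T (c h) (c s') (\<lambda>r. c (h + r))"
    using geodesic_part[OF c] s(2) s'(3) lt h by (auto simp: L_def)
  have g3: "geodesic T (c s') (c s) (\<lambda>r. c' (s' - r))"
  proof -
    have "geodesic T (c' s) (c' s') (\<lambda>r. c' (s + r))"
      by (rule geodesic_part[OF c']) (use s(2) s'(3) lt in \<open>auto simp: L_def\<close>)
    moreover have "mdist T (c' s) (c' s') = s' - s" using dd(3) by (simp add: mdist_commute)
    ultimately show ?thesis using geodesic_rev[of T "c' s" "c' s'" "\<lambda>r. c' (s + r)"] same by (simp add: algebra_simps)
  qed
  have "\<exists>g. embedding_map (top_of_set (sphere (0::complex) 1)) (mtopology_of T) g"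
  proof (rule geodesic_triangle_imp_embedded_circle[OF g1 g2 g3])
    show "c s \<in> mspace T" "c h \<in> mspace T" "c s' \<in> mspace T" using C(3) s(2) s'(3) lt h by auto
    show "c s \<noteq> c h" "c h \<noteq> c s'" "c s' \<noteq> c s"
      using C(6)[of s] C(6)[of h] C(6)[of s'] s(2) s'(3) lt h by auto
  next
    fix i j assume "i \<in> {0..mdist T (c s) (c h)}" "j \<in> {0..mdist T (c h) (c s')}"
      and ceq: "c (s + i) = c (h + j)"
    then have ij: "0 \<le> i" "i \<le> h - s" "0 \<le> j" "j \<le> s' - h" using dd by simp_all
    have "mdist T u (c (s + i)) = s + i" "mdist T u (c (h + j)) = h + j"
      using ij s(2) s'(3) lt h by (intro C(6); linarith)+
    then have "s + i = h" using ij unfolding ceq by linarith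
    then show "c (s + i) = c h" by simp
  next
    fix i j assume "i \<in> {0..mdist T (c h) (c s')}" "j \<in> {0..mdist T (c s') (c s)}"
      and ceq: "c (h + i) = c' (s' - j)"
    then have ij: "0 \<le> i" "i \<le> s' - h" "0 \<le> j" "j \<le> s' - s" using dd same by simp_all
    have "h + i = s' - j"
      by (rule meet[OF _ _ _ _ ceq]) (use ij s(2) s'(3) lt h in linarith)+
    then have "c (h + i) = c' (h + i)" using ceq by simp
    then have "h + i \<in> E" using ij d0[of "h + i"] s(2) s'(3) lt h by (simp add: E_def)
    then have "h + i = s'" using noE[of "h+i"] ij lt by linarith
    then show "c (h + i) = c s'" by simp
  next
    fix i j assume "i \<in> {0..mdist T (c s) (c h)}" "j \<in> {0..mdist T (c s') (c s)}"
      and ceq: "c (s + i) = c' (s' - j)"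
    then have ij: "0 \<le> i" "i \<le> h - s" "0 \<le> j" "j \<le> s' - s" using dd same by simp_all
    have "s + i = s' - j"
      by (rule meet[OF _ _ _ _ ceq]) (use ij s(2) s'(3) lt h in linarith)+
    then have "c (s + i) = c' (s + i)" using ceq by simp
    then have "s + i \<in> E" using ij d0[of "s + i"] s(2) s'(3) lt h by (simp add: E_def)
    then have "s + i = s" using noE[of "s+i"] ij lt by linarith
    then show "c (s + i) = c s" by simp
  qed
  then show False using nc by blast
qed

text \<open>The point where the geodesics from \<open>x\<close> to \<open>y\<close> and from
  \<open>x\<close> to \<open>z\<close> separate.\<close>

lemma no_circle_branch_point:
  assumes geo: "geodesic_space T"
    and nc: "\<nexists>g. embedding_map (top_of_set (sphere (0::complex) 1)) (mtopology_of T) g"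
    and xyz: "x \<in> mspace T" "y \<in> mspace T" "z \<in> mspace T"
  obtains m where "btw T x m y" "btw T x m z" "\<And>w. btw T m w y \<Longrightarrow> btw T m w z \<Longrightarrow> w = m"
proof -
  obtain c where c: "geodesic T x y c" using geo xyz unfolding geodesic_space_def by blast
  define L where "L = mdist T x y"
  note C = geodesicD[OF c, folded L_def] geodesic_btw[OF c, folded L_def]
  \<comment> \<open>\<open>c t\<close> lies on \<open>[x,z]\<close> exactly when \<open>\<delta> t\<close> equals
    the distance from \<open>x\<close> to \<open>z\<close>, so the separation point is the last time
    with this value.\<close>
  define \<delta> where "\<delta> t = mdist T (c t) z + t" for t
  have L0: "0 \<le> L" by (simp add: L_def)
  have lip: "\<bar>\<delta> s - \<delta> t\<bar> \<le> 2 * \<bar>s - t\<bar>" if st: "0 \<le> s" "s \<le> L" "0 \<le> t" "t \<le> L" for s t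
  proof -
    have m: "c s \<in> mspace T" "c t \<in> mspace T" using st C(3) by auto
    have "\<delta> s - \<delta> t \<le> \<bar>s - t\<bar> + (s - t)"
      unfolding \<delta>_def using mdist_triangle[OF m(1) m(2) xyz(3)] C(4)[OF st] by linarith
    moreover have "\<delta> t - \<delta> s \<le> \<bar>s - t\<bar> + (t - s)"
      unfolding \<delta>_def using mdist_triangle[OF m(2) m(1) xyz(3)] C(4)[OF st]
        mdist_commute[of T "c t" "c s"] by linarith
    moreover have "s - t \<le> \<bar>s - t\<bar>" "t - s \<le> \<bar>s - t\<bar>" by auto
    ultimately have "\<delta> s - \<delta> t \<le> 2 * \<bar>s - t\<bar>" "- (\<delta> s - \<delta> t) \<le> 2 * \<bar>s - t\<bar>" by argo+
    then show ?thesis by (rule abs_leI)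
  qed
  have cont: "continuous_on {0..L} \<delta>"
    by (rule lipschitz_on_continuous_on[of 2], rule lipschitz_onI) (use lip in \<open>auto simp: dist_real_def\<close>)
  define K where "K = {t \<in> {0..L}. \<delta> t = mdist T x z}"
  have "closed K"
    unfolding K_def using continuous_closed_preimage_constant[OF cont] by simp
  moreover have "K = K \<inter> {0..L}" by (auto simp: K_def)
  ultimately have comp: "compact K" using closed_Int_compact[of K "{0..L}"] by simp
  have "0 \<in> K" using C(1) L0 by (simp add: K_def \<delta>_def)
  then have "K \<noteq> {}" by blast
  then obtain s where s: "s \<in> K" "\<And>t. t \<in> K \<Longrightarrow> t \<le> s"
    using compact_attains_sup[OF comp] by blast
  then have sL: "0 \<le> s" "s \<le> L" and ds: "mdist T (c s) z + s = mdist T x z"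
    by (auto simp: K_def \<delta>_def)
  have b: "btw T x (c s) y" "btw T x (c s) z"
    using C(5,6)[OF sL] C(3)[OF sL] ds by (auto simp: btw_def)
  show ?thesis
  proof (rule that[OF b])
    fix w assume w: "btw T (c s) w y" "btw T (c s) w z"
    have wy: "btw T x w y" "btw T x (c s) w" and wz: "btw T x w z"
      using btw_trans'[OF xyz(1,2) b(1) w(1)] btw_trans'[OF xyz(1,3) b(2) w(2)] by auto
    define t where "t = mdist T x w"
    have t: "0 \<le> t" "t \<le> L" using btw_le(1)[OF wy(1)] by (auto simp: t_def L_def)
    have "c t = w"
      using no_circle_btw_unique[OF geo nc xyz(1,2) C(5)[OF t] wy(1)] C(6)[OF t] by (simp add: t_def)
    then have "\<delta> t = mdist T x z" using wz by (simp add: \<delta>_def t_def btw_def)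
    then have "t \<le> s" using s(2)[of t] t by (simp add: K_def)
    moreover have "mdist T x (c s) + mdist T (c s) w = mdist T x w" using wy(2) by (simp add: btw_def)
    ultimately have "mdist T (c s) w \<le> 0" using C(6)[OF sL] unfolding t_def by linarith
    then have "mdist T (c s) w = 0" using mdist_nonneg[of T "c s" w] by linarith
    then show "w = c s" using C(3)[OF sL] btw_mspace[OF w(1)] by simp
  qed
qed

lemma no_circle_no_triangle:
  assumes geo: "geodesic_space T"
    and nc: "\<nexists>g. embedding_map (top_of_set (sphere (0::complex) 1)) (mtopology_of T) g"
    and abc: "a \<in> mspace T" "b \<in> mspace T" "c \<in> mspace T"
    and a: "\<And>w. btw T a w b \<Longrightarrow> btw T a w c \<Longrightarrow> w = a"
    and b: "\<And>w. btw T b w a \<Longrightarrow> btw T b w c \<Longrightarrow> w = b"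
    and c: "\<And>w. btw T c w a \<Longrightarrow> btw T c w b \<Longrightarrow> w = c"
  shows "a = b \<or> b = c \<or> c = a"
proof (rule ccontr)
  assume ne: "\<not> ?thesis"
  obtain c1 c2 c3 where g: "geodesic T a b c1" "geodesic T b c c2" "geodesic T c a c3"
    using geo abc unfolding geodesic_space_def by blast
  have "\<exists>g. embedding_map (top_of_set (sphere (0::complex) 1)) (mtopology_of T) g"
  proof (rule geodesic_triangle_imp_embedded_circle[OF g abc])
    fix s t assume "s \<in> {0..mdist T a b}" "t \<in> {0..mdist T b c}" "c1 s = c2 t"
    then show "c1 s = b"
      using geodesic_btw(1)[OF g(1), of s] geodesic_btw(1)[OF g(2), of t] b[of "c1 s"]
      by (auto simp: btw_commute[of T a])
  next
    fix s t assume "s \<in> {0..mdist T b c}" "t \<in> {0..mdist T c a}" "c2 s = c3 t"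
    then show "c2 s = c"
      using geodesic_btw(1)[OF g(2), of s] geodesic_btw(1)[OF g(3), of t] c[of "c2 s"]
      by (auto simp: btw_commute[of T b])
  next
    fix s t assume "s \<in> {0..mdist T a b}" "t \<in> {0..mdist T c a}" "c1 s = c3 t"
    then show "c1 s = a"
      using geodesic_btw(1)[OF g(1), of s] geodesic_btw(1)[OF g(3), of t] a[of "c1 s"]
      by (auto simp: btw_commute[of T c])
  qed (use ne in auto)
  then show False using nc by blast
qed

text \<open>Start from the branch point \<open>m\<close> of \<open>[x,y]\<close> and \<open>[x,z]\<close>.
  If it is not on \<open>[y,z]\<close>, then branching again, first from \<open>y\<close> and then
  from \<open>z\<close>, gives points \<open>n\<close> and \<open>k\<close> such that the triangle
  with vertices \<open>m, n, k\<close> has sides that meet only at vertices.\<close>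

lemma no_circle_median:
  assumes geo: "geodesic_space T"
    and nc: "\<nexists>g. embedding_map (top_of_set (sphere (0::complex) 1)) (mtopology_of T) g"
    and xyz: "x \<in> mspace T" "y \<in> mspace T" "z \<in> mspace T"
  obtains m where "btw T x m y" "btw T y m z" "btw T x m z"
proof -
  obtain m where m: "btw T x m y" "btw T x m z" "\<And>w. btw T m w y \<Longrightarrow> btw T m w z \<Longrightarrow> w = m"
    using no_circle_branch_point[OF geo nc xyz] by metis
  have mM: "m \<in> mspace T" by (rule btw_mspace[OF m(1)])
  obtain n where n: "btw T y n m" "btw T y n z" "\<And>w. btw T n w m \<Longrightarrow> btw T n w z \<Longrightarrow> w = n"
    using no_circle_branch_point[OF geo nc xyz(2) mM xyz(3)] by metis
  have nM: "n \<in> mspace T" by (rule btw_mspace[OF n(1)])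
  obtain k where k: "btw T z k m" "btw T z k n" "\<And>w. btw T k w m \<Longrightarrow> btw T k w n \<Longrightarrow> w = k"
    using no_circle_branch_point[OF geo nc xyz(3) mM nM] by metis
  have kM: "k \<in> mspace T" by (rule btw_mspace[OF k(1)])
  have ny: "btw T m n y" using n(1) by (simp add: btw_commute)
  have kz: "btw T m k z" using k(1) by (simp add: btw_commute)
  have "m = n \<or> n = k \<or> k = m"
  proof (rule no_circle_no_triangle[OF geo nc mM nM kM])
    show "w = m" if "btw T m w n" "btw T m w k" for w
      using m(3) btw_trans(1)[OF mM xyz(2) ny that(1)] btw_trans(1)[OF mM xyz(3) kz that(2)] by blast
    show "w = n" if "btw T n w m" "btw T n w k" for w
    proof (rule n(3)[OF that(1)])
      show "btw T n w z"
        by (rule btw_trans(1)[OF nM xyz(3) _ that(2)]) (use k(2) in \<open>simp add: btw_commute\<close>)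
    qed
    show "w = k" if "btw T k w m" "btw T k w n" for w
      by (rule k(3)[OF that])
  qed
  then have "btw T y m z"
  proof (elim disjE)
    assume "m = n" then show ?thesis using n(2) by simp
  next
    assume "n = k"
    then have "n = m" using m(3)[OF ny] kz by simp
    then show ?thesis using n(2) by simp
  next
    assume km: "k = m"
    show ?thesis
      using btw_trans(1)[OF xyz(3,2), of n m] n(2) k(2) km by (simp add: btw_commute)
  qed
  then show ?thesis using that m by blast
qed

text \<open>If \<open>m\<close> is the median of \<open>x, y, z\<close>, then \<open>m\<close> separates
  \<open>w\<close> from at least two of these three points. This determines enough of the
  distances from \<open>w\<close> to compare the three sums.\<close>

lemma real_tree_imp_four_point:
  assumes "real_tree T"
  shows "four_point T"
proof -
  have geo: "geodesic_space T"
    and nc: "\<nexists>g. embedding_map (top_of_set (sphere (0::complex) 1)) (mtopology_of T) g"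
    using assms by (auto simp: real_tree_def)
  \<comment> \<open>A point of \<open>[u,w]\<close> lies on \<open>[u,v]\<close> or on \<open>[v,w]\<close>: compare
    its position with that of the median.\<close>
  have split: "btw T u m v \<or> btw T v m w"
    if M: "u \<in> mspace T" "v \<in> mspace T" "w \<in> mspace T" and m: "btw T u m w" for u v w m
  proof -
    obtain n where n: "btw T u n v" "btw T v n w" "btw T u n w"
      using no_circle_median[OF geo nc M] by metis
    obtain c where c: "geodesic T u w c" and cn: "c (mdist T u n) = n"
      using geodesic_through[OF geo M(1,3) n(3)] .
    have l: "0 \<le> mdist T u m" "mdist T u m \<le> mdist T u w" "0 \<le> mdist T u n" "mdist T u n \<le> mdist T u w"
      using btw_le(1)[OF m] btw_le(1)[OF n(3)] by auto
    have cm: "c (mdist T u m) = m"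
      using no_circle_btw_unique[OF geo nc M(1,3) geodesic_btw(1)[OF c l(1,2)] m]
        geodesic_btw(2)[OF c l(1,2)] by simp
    have mn: "mdist T m n = \<bar>mdist T u m - mdist T u n\<bar>"
      using geodesicD(4)[OF c l] cm cn by simp
    have sums: "mdist T u m + mdist T m w = mdist T u w" "mdist T u n + mdist T n w = mdist T u w"
      and mM: "m \<in> mspace T" and nM: "n \<in> mspace T" using m n by (auto simp: btw_def)
    show ?thesis
    proof (cases "mdist T u m \<le> mdist T u n")
      case True
      then have "mdist T u m + mdist T m n = mdist T u n" using mn by linarith
      then have "btw T u m n" using mM by (simp add: btw_def)
      then show ?thesis using btw_trans(1)[OF M(1,2) n(1)] by blast
    next
      case False
      then have "mdist T n m + mdist T m w = mdist T n w" using mn sums mdist_commute[of T m n] by linarith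
      then have "btw T n m w" using mM by (simp add: btw_def)
      then show ?thesis using btw_trans'(1)[OF M(2,3) n(2)] by blast
    qed
  qed
  show ?thesis
    unfolding four_point_def
  proof (intro ballI)
    fix x y z w assume M: "x \<in> mspace T" "y \<in> mspace T" "z \<in> mspace T" "w \<in> mspace T"
    obtain m where m: "btw T x m y" "btw T y m z" "btw T x m z"
      using no_circle_median[OF geo nc M(1-3)] by metis
    have mM: "m \<in> mspace T" by (rule btw_mspace[OF m(1)])
    define X Y Z W where "X = mdist T x m" and "Y = mdist T y m" and "Z = mdist T z m" and "W = mdist T m w"
    have e: "mdist T x y = X + Y" "mdist T y z = Y + Z" "mdist T x z = X + Z"
      using m by (auto simp: btw_def X_def Y_def Z_def mdist_commute[of T m])
    have le: "mdist T x w \<le> X + W" "mdist T y w \<le> Y + W" "mdist T z w \<le> Z + W"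
      unfolding X_def Y_def Z_def W_def by (intro mdist_triangle M mM)+
    have eq: "btw T x m w \<Longrightarrow> mdist T x w = X + W" "btw T y m w \<Longrightarrow> mdist T y w = Y + W"
      "btw T z m w \<Longrightarrow> mdist T z w = Z + W"
      by (auto simp: btw_def X_def Y_def Z_def W_def)
    have "(btw T x m w \<and> btw T y m w) \<or> (btw T x m w \<and> btw T z m w) \<or> (btw T y m w \<and> btw T z m w)"
      using split[OF M(1,4,2) m(1)] split[OF M(2,4,3) m(2)] split[OF M(1,4,3) m(3)]
      by (auto simp: btw_commute[of T w])
    then consider "mdist T x w = X + W" "mdist T y w = Y + W"
      | "mdist T x w = X + W" "mdist T z w = Z + W"
      | "mdist T y w = Y + W" "mdist T z w = Z + W" using eq by blast
    then show "mdist T x y + mdist T z w \<le> max (mdist T x z + mdist T y w) (mdist T x w + mdist T y z)"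
      using e le by cases linarith+
  qed
qed

section \<open>Directions in geodesic four-point spaces\<close>

lemma openin_mtopology_of:
  "openin (mtopology_of T) U \<longleftrightarrow>
     U \<subseteq> mspace T \<and> (\<forall>x\<in>U. \<exists>r>0. \<forall>y\<in>mspace T. mdist T x y < r \<longrightarrow> y \<in> U)"
proof -
  interpret Metric_space "mspace T" "mdist T" by simp
  have "mball x r \<subseteq> U \<longleftrightarrow> (\<forall>y\<in>mspace T. mdist T x y < r \<longrightarrow> y \<in> U)" if "x \<in> mspace T" for x r
    using that by (auto simp: in_mball)
  then have "U \<subseteq> mspace T \<Longrightarrow> (\<forall>x. x \<in> U \<longrightarrow> (\<exists>r>0. mball x r \<subseteq> U)) \<longleftrightarrow>
      (\<forall>x\<in>U. \<exists>r>0. \<forall>y\<in>mspace T. mdist T x y < r \<longrightarrow> y \<in> U)"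
    by (metis subsetD)
  then show ?thesis
    unfolding mtopology_of_def openin_mtopology by blast
qed

text \<open>Metric real trees, except that the empty space is admitted.\<close>

locale rtree =
  fixes T :: "'a metric"
  assumes geo: "geodesic_space T"
    and fp: "four_point T"
begin

abbreviation "M \<equiv> mspace T"
abbreviation "d \<equiv> mdist T"

lemma four_pointD:
  assumes "x \<in> M" "y \<in> M" "z \<in> M" "w \<in> M"
  shows "d x y + d z w \<le> max (d x z + d y w) (d x w + d y z)"
  using fp assms unfolding four_point_def by blast

lemma btw_unique:
  assumes "u \<in> M" "v \<in> M" "btw T u x v" "btw T u y v" "d u x = d u y"
  shows "x = y"
proof -
  have M: "x \<in> M" "y \<in> M" using assms by (auto simp: btw_def)
  have "d u v + d x y \<le> max (d u x + d v y) (d u y + d v x)"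
    by (rule four_pointD[OF assms(1,2) M])
  moreover have "d u x + d v x = d u v" "d u y + d v y = d u v"
    using assms(3,4) mdist_commute[of T v x] mdist_commute[of T v y] by (auto simp: btw_def)
  ultimately have "d x y \<le> 0" using assms(5) by linarith
  then have "d x y = 0" using mdist_nonneg[of T x y] by linarith
  then show ?thesis using M by simp
qed

text \<open>The point of \<open>[x,y]\<close> at the distance from \<open>x\<close> that is the Gromov
  product of \<open>y\<close> and \<open>z\<close>.\<close>

lemma median:
  assumes "x \<in> M" "y \<in> M" "z \<in> M"
  obtains m where "btw T x m y" "btw T y m z" "btw T x m z"
proof -
  note tri = mdist_triangle[OF assms(1,2,3)] mdist_triangle[OF assms(1,3,2)] mdist_triangle[OF assms(2,1,3)]
    mdist_commute[of T y x] mdist_commute[of T z y] mdist_commute[of T z x]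
  have "0 \<le> (d x y + d x z - d y z) / 2" "(d x y + d x z - d y z) / 2 \<le> d x y"
    using tri by auto
  then obtain m where m: "btw T x m y" "d x m = (d x y + d x z - d y z) / 2"
      "d m y = d x y - (d x y + d x z - d y z) / 2"
    using geodesic_space_point[OF geo assms(1,2)] by metis
  have mM: "m \<in> M" by (rule btw_mspace[OF m(1)])
  have "d x y + d z m \<le> max (d x z + d y m) (d x m + d y z)"
    by (rule four_pointD[OF assms mM])
  then have le: "d z m \<le> (d x z + d y z - d x y) / 2"
    using m mdist_commute[of T y m] by (auto simp: field_simps)
  moreover have "d x z \<le> d x m + d m z" "d y z \<le> d y m + d m z"
    using assms mM by (auto intro: mdist_triangle)
  ultimately have "btw T x m z" "btw T y m z"
    using m mM mdist_commute[of T z m] mdist_commute[of T y m] by (auto simp: btw_def field_simps)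
  then show ?thesis using that m(1) by blast
qed

lemma btw_cases:
  assumes "u \<in> M" "v \<in> M" "w \<in> M" "btw T u x w"
  shows "btw T u x v \<or> btw T v x w"
proof -
  have x: "x \<in> M" by (rule btw_mspace[OF assms(4)])
  have "d u w + d x v \<le> max (d u x + d w v) (d u v + d w x)"
    by (rule four_pointD[OF assms(1,3) x assms(2)])
  moreover have "d u x + d x w = d u w" using assms by (simp add: btw_def)
  moreover have "d w v \<le> d w x + d x v" "d u v \<le> d u x + d x v"
    using assms x by (auto intro: mdist_triangle)
  ultimately have "d u x + d x v = d u v \<or> d v x + d x w = d v w"
    using mdist_commute[of T v w] mdist_commute[of T x w] mdist_commute[of T v x] by linarith
  then show ?thesis using x by (auto simp: btw_def)
qed

text \<open>For \<open>u \<noteq> x\<close> this is the direction at \<open>x\<close> that contains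
  \<open>u\<close> (\<open>directions_eq_sides\<close>).\<close>

definition side :: "'a \<Rightarrow> 'a \<Rightarrow> 'a set" where
  "side x u = {v \<in> M. \<not> btw T u x v}"

text \<open>A ball that does not reach \<open>x\<close> lies on one side of \<open>x\<close>; hence sides
  are open and closed away from \<open>x\<close>.\<close>

lemma side_ball:
  assumes "u \<in> M" "x \<in> M" "v \<in> M" "w \<in> M" "d v w < d v x"
  shows "btw T u x v \<longleftrightarrow> btw T u x w"
proof -
  have "\<not> btw T v x w" "\<not> btw T w x v" using assms(5) btw_le(1)[of T v x w] by (auto simp: btw_commute)
  then show ?thesis using btw_cases[of u w v x] btw_cases[of u v w x] assms by blast
qed

lemma openin_side:
  assumes "u \<in> M" "x \<in> M"
  shows "openin (mtopology_of T) (side x u)" "openin (mtopology_of T) (M - {x} - side x u)"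
proof -
  have "d v x > 0" if "v \<in> M" "v \<noteq> x" for v
    using that assms mdist_nonneg[of T v x] by (simp add: order_less_le)
  moreover have "v \<noteq> x" if "v \<in> side x u" for v using that assms by (auto simp: side_def)
  ultimately show "openin (mtopology_of T) (side x u)"
    using side_ball[OF assms] unfolding openin_mtopology_of side_def by blast
  have "w \<noteq> x" if "d v w < d v x" for v w using that by auto
  then show "openin (mtopology_of T) (M - {x} - side x u)"
    using side_ball[OF assms] \<open>\<And>v. v \<in> M \<Longrightarrow> v \<noteq> x \<Longrightarrow> d v x > 0\<close>
    unfolding openin_mtopology_of side_def by blast
qed

lemma connected_avoiding_same_side:
  assumes K: "connectedin (mtopology_of T) K" and u: "u \<in> K" and v: "v \<in> K" and x: "x \<in> M" "x \<notin> K"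
  shows "\<not> btw T u x v"
proof
  assume b: "btw T u x v"
  have KM: "K \<subseteq> M" using connectedin_subset_topspace[OF K] by simp
  have uM: "u \<in> M" using KM u by blast
  have "u \<in> side x u" using uM x u btw_self[of u T x] by (auto simp: side_def)
  moreover have "v \<in> M - {x} - side x u" using KM v x b by (auto simp: side_def)
  moreover have "K \<subseteq> side x u \<union> (M - {x} - side x u)" using KM x by auto
  ultimately show False
    using K openin_side[OF uM x(1)] u v unfolding connectedin by blast
qed

lemma connectedin_side:
  assumes "u \<in> M" "x \<in> M" "x \<noteq> u"
  shows "connectedin (mtopology_of T) (side x u)"
proof -
  have "\<exists>K. connectedin (mtopology_of T) K \<and> K \<subseteq> side x u \<and> u \<in> K \<and> v \<in> K" if v: "v \<in> side x u" for v
  proof -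
    have vM: "v \<in> M" and nb: "\<not> btw T u x v" using v by (auto simp: side_def)
    obtain c where c: "geodesic T u v c" using geo assms vM unfolding geodesic_space_def by blast
    have "connectedin (mtopology_of T) (c ` {0..d u v})"
      by (rule connectedin_continuous_map_image[OF geodesic_continuous[OF c]]) (simp add: connectedin_absolute)
    moreover have "c ` {0..d u v} \<subseteq> side x u"
    proof clarify
      fix t assume t: "t \<in> {0..d u v}"
      have b: "btw T u (c t) v" using geodesic_btw(1)[OF c] t by simp
      then show "c t \<in> side x u"
        using btw_mspace[OF b] btw_trans(1)[OF assms(1) vM b, of x] nb by (auto simp: side_def)
    qed
    moreover have "u \<in> c ` {0..d u v}" "v \<in> c ` {0..d u v}"
      using geodesicD(1,2)[OF c] by (auto intro: image_eqI[of _ _ 0] image_eqI[of _ _ "d u v"])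
    ultimately show ?thesis by blast
  qed
  then obtain K where K: "\<And>v. v \<in> side x u \<Longrightarrow>
      connectedin (mtopology_of T) (K v) \<and> K v \<subseteq> side x u \<and> u \<in> K v \<and> v \<in> K v" by metis
  have "connectedin (mtopology_of T) (\<Union>(K ` side x u))"
  proof (rule connectedin_Union)
    show "\<Inter> (K ` side x u) \<noteq> {}" using K by blast
  qed (use K in auto)
  moreover have "\<Union>(K ` side x u) = side x u" using K by blast
  ultimately show ?thesis by simp
qed

lemma directions_eq_sides:
  assumes x: "x \<in> M"
  shows "directions T x = side x ` (M - {x})"
proof -
  let ?X = "subtopology (mtopology_of T) (M - {x})"
  have ts: "topspace ?X = M - {x}" by auto
  have "connected_component_of_set ?X u = side x u" if u: "u \<in> M - {x}" for u
  proof (intro equalityI subsetI)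
    fix v assume "v \<in> connected_component_of_set ?X u"
    then obtain K where "connectedin ?X K" "u \<in> K" "v \<in> K" by (auto simp: connected_component_of_def)
    then have K: "connectedin (mtopology_of T) K" "K \<subseteq> M - {x}" "u \<in> K" "v \<in> K"
      by (auto simp: connectedin_subtopology)
    then have "\<not> btw T u x v" by (intro connected_avoiding_same_side[OF K(1)] x) auto
    then show "v \<in> side x u" using K by (auto simp: side_def)
  next
    fix v assume v: "v \<in> side x u"
    have "side x u \<subseteq> M - {x}" using u by (auto simp: side_def)
    then have "connectedin ?X (side x u)"
      using connectedin_side[of u x] u x by (auto simp: connectedin_subtopology)
    moreover have "u \<in> side x u" using u btw_self[of u T x] by (auto simp: side_def)
    ultimately show "v \<in> connected_component_of_set ?X u"
      using v by (auto simp: connected_component_of_def)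
  qed
  then show ?thesis
    unfolding directions_def connected_components_of_def ts by (auto intro!: image_cong)
qed

end

text \<open>An embedded circle passes through two distinct points \<open>a\<close> and \<open>b\<close>, the
  images of \<open>1\<close> and \<open>-1\<close>, along two half circles. Both are connected, so
  both pass through the midpoint \<open>x\<close> of \<open>[a,b]\<close>, which contradicts
  injectivity: one parameter has positive imaginary part and the other has not.\<close>

lemma rtree_imp_real_tree:
  assumes geo: "geodesic_space T" and fp: "four_point T" and ne: "mspace T \<noteq> {}"
  shows "real_tree T"
proof -
  interpret rtree T using geo fp by unfold_locales
  have False if f: "embedding_map (top_of_set (sphere (0::complex) 1)) (mtopology_of T) f" for f
  proof -
    define e where "e t = cis (pi * t)" for t :: real
    have inj: "inj_on f (sphere 0 1)" and cont: "continuous_map (top_of_set (sphere 0 1)) (mtopology_of T) f"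
      using f unfolding embedding_map_def homeomorphic_eq_everything_map continuous_map_in_subtopology
      by simp_all
    have fM: "f z \<in> M" if "z \<in> sphere 0 1" for z
      using continuous_map_image_subset_topspace[OF cont] that by auto
    have half: "connectedin (mtopology_of T) (f ` e ` {a..b})" for a b
    proof -
      have "continuous_on {a..b} e" unfolding e_def by (intro continuous_intros)
      then have "connected (e ` {a..b})" by (intro connected_continuous_image) auto
      moreover have "e ` {a..b} \<subseteq> sphere 0 1" by (auto simp: e_def)
      ultimately show ?thesis
        by (intro connectedin_continuous_map_image[OF cont])
          (simp add: connectedin_subtopology)
    qed
    have e: "e 0 = 1" "e 1 = -1" "e 2 = 1"
      using cis_2pi by (auto simp: e_def mult.commute)
    define a b where "a = f 1" and "b = f (-1)"
    have ab: "a \<in> M" "b \<in> M" "a \<noteq> b"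
      using fM inj_onD[OF inj, of 1 "-1"] by (auto simp: a_def b_def)
    then have dpos: "d a b > 0" using mdist_nonneg[of T a b] by (simp add: order_less_le)
    then obtain x where x: "btw T a x b" "d a x = d a b / 2" "d x b = d a b - d a b / 2"
      using geodesic_space_point[OF geo ab(1,2), of "d a b / 2"] by auto
    have xM: "x \<in> M" by (rule btw_mspace[OF x(1)])
    have xab: "x \<noteq> a" "x \<noteq> b" using x dpos ab by auto
    have "f (e 0) \<in> f ` e ` {0..1}" "f (e 1) \<in> f ` e ` {0..1}"
      "f (e 1) \<in> f ` e ` {1..2}" "f (e 2) \<in> f ` e ` {1..2}" by (intro imageI; simp)+
    then have mem: "a \<in> f ` e ` {0..1}" "b \<in> f ` e ` {0..1}" "b \<in> f ` e ` {1..2}" "a \<in> f ` e ` {1..2}"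
      by (simp_all only: e a_def b_def)
    have "x \<in> f ` e ` {0..1}"
      using connected_avoiding_same_side[OF half mem(1,2) xM] x(1) by blast
    moreover have "x \<in> f ` e ` {1..2}"
      using connected_avoiding_same_side[OF half mem(4,3) xM] x(1) by blast
    ultimately obtain s t where s: "0 \<le> s" "s \<le> 1" "x = f (e s)" and t: "1 \<le> t" "t \<le> 2" "x = f (e t)"
      by auto
    have "e s = e t" using inj_onD[OF inj, of "e s" "e t"] s t by (simp add: e_def)
    then have "sin (pi * s) = sin (pi * t)" by (auto simp: e_def complex_eq_iff)
    moreover have "sin (pi * s) > 0"
    proof (rule sin_gt_zero)
      have "s \<noteq> 0" "s \<noteq> 1" using s xab e by (auto simp: a_def b_def)
      then show "0 < pi * s" "pi * s < pi" using s by auto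
    qed
    moreover have "sin (pi * t) \<le> 0"
      using sin_ge_zero[of "pi * t - pi"] t by (simp add: algebra_simps sin_diff)
    ultimately show False by linarith
  qed
  then show ?thesis using geo ne by (auto simp: real_tree_def)
qed

lemma real_tree_imp_rtree: "real_tree T \<Longrightarrow> rtree T"
  using real_tree_imp_four_point by (simp add: rtree_def real_tree_def)

section \<open>Half-spaces\<close>

definition halfspace :: "'a metric \<Rightarrow> 'a set \<Rightarrow> bool" where
  "halfspace T A \<longleftrightarrow> (\<exists>x\<in>mspace T. A \<in> directions T x)"

definition opposite :: "'a metric \<Rightarrow> 'a set \<Rightarrow> 'a set \<Rightarrow> bool" where
  "opposite T A A' \<longleftrightarrow> (\<exists>x\<in>mspace T. A \<in> directions T x \<and> A' \<in> directions T x \<and> A \<noteq> A')"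

lemma opposite_sym: "opposite T A A' \<Longrightarrow> opposite T A' A"
  by (auto simp: opposite_def)

lemma opposite_halfspace: "opposite T A A' \<Longrightarrow> halfspace T A" "opposite T A A' \<Longrightarrow> halfspace T A'"
  by (auto simp: opposite_def halfspace_def)

context rtree
begin

text \<open>On a segment, distances are differences of distances from an endpoint.\<close>

lemma btw_dist:
  assumes "u \<in> M" "v \<in> M" "btw T u x v" "btw T u y v"
  shows "d x y = \<bar>d u x - d u y\<bar>"
proof -
  have M: "x \<in> M" "y \<in> M" using assms by (auto simp: btw_def)
  have 1: "d u v + d x y \<le> max (d u x + d v y) (d u y + d v x)"
    by (rule four_pointD[OF assms(1,2) M])
  have 2: "d u x + d v x = d u v" "d u y + d v y = d u v"
    using assms(3,4) mdist_commute[of T v x] mdist_commute[of T v y] by (auto simp: btw_def)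
  have 3: "d u x \<le> d u y + d x y" "d u y \<le> d u x + d x y"
    using mdist_triangle[OF assms(1) M(2) M(1)] mdist_triangle[OF assms(1) M(1) M(2)]
      mdist_commute[of T y x] by auto
  show ?thesis
  proof (cases "d u x \<le> d u y")
    case True
    then have "d x y = d u y - d u x" using 1 2 3 by linarith
    then show ?thesis using True by simp
  next
    case False
    then have "d x y = d u x - d u y" using 1 2 3 by linarith
    then show ?thesis using False by simp
  qed
qed

lemma btw_ordered:
  assumes "u \<in> M" "v \<in> M" "btw T u x v" "btw T u y v" "d u x \<le> d u y"
  shows "btw T u x y" "btw T x y v"
proof -
  have "d x y = d u y - d u x" using btw_dist[OF assms(1-4)] assms(5) by simp
  then show "btw T u x y" "btw T x y v" using assms(3,4) by (auto simp: btw_def)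
qed

lemma side_self: "u \<in> M \<Longrightarrow> u \<noteq> x \<Longrightarrow> u \<in> side x u"
  using btw_self[of u T x] by (auto simp: side_def)

lemma side_eq:
  assumes "u \<in> M" "x \<in> M" "v \<in> side x u"
  shows "side x v = side x u"
proof -
  have v: "v \<in> M" "\<not> btw T u x v" "\<not> btw T v x u" using assms by (auto simp: side_def btw_commute)
  have "btw T v x w \<longleftrightarrow> btw T u x w" if w: "w \<in> M" for w
    using btw_cases[OF v(1) assms(1) w, of x] btw_cases[OF assms(1) v(1) w, of x] v(2,3) by blast
  then show ?thesis by (auto simp: side_def)
qed

lemma halfspace_side: "u \<in> M \<Longrightarrow> x \<in> M \<Longrightarrow> u \<noteq> x \<Longrightarrow> halfspace T (side x u)"
  by (auto simp: halfspace_def directions_eq_sides)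

lemma halfspaceE:
  assumes "halfspace T A"
  obtains x u where "x \<in> M" "u \<in> M" "u \<noteq> x" "A = side x u"
  using assms by (auto simp: halfspace_def directions_eq_sides)

lemma halfspace_as_side:
  assumes "halfspace T A" "v \<in> A"
  obtains x where "x \<in> M" "v \<in> M" "v \<noteq> x" "A = side x v"
proof -
  obtain x u where x: "x \<in> M" "u \<in> M" "u \<noteq> x" "A = side x u" using assms(1) by (rule halfspaceE)
  then have "A = side x v" "v \<in> M" using side_eq[of u x v] assms(2) by (auto simp: side_def)
  moreover have "v \<noteq> x" using assms(2) x by (auto simp: side_def)
  ultimately show ?thesis using that x by blast
qed

lemma halfspace_convex:
  assumes A: "halfspace T A" and "u \<in> A" "v \<in> A" "btw T u m v"
  shows "m \<in> A"
proof -
  obtain x where x: "x \<in> M" "u \<in> M" "A = side x u" using halfspace_as_side[OF A assms(2)] by metis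
  then have v: "v \<in> M" "\<not> btw T u x v" using assms(3) by (auto simp: side_def)
  then show ?thesis
    using x btw_trans(1)[OF x(2) v(1) assms(4), of x] btw_mspace[OF assms(4)] by (auto simp: side_def)
qed

lemma halfspace_coconvex:
  assumes A: "halfspace T A" and "u \<in> M" "v \<in> M" "m \<in> A" "btw T u m v"
  shows "u \<in> A \<or> v \<in> A"
proof (rule ccontr)
  assume n: "\<not> ?thesis"
  obtain x where x: "x \<in> M" "m \<in> M" "m \<noteq> x" "A = side x m" using halfspace_as_side[OF A assms(4)] .
  then have b: "btw T m x u" "btw T m x v" using n assms by (auto simp: side_def)
  have "d u v \<le> d u x + d x v" using assms x by (intro mdist_triangle) auto
  moreover have "d u m + d m v = d u v" "d m x + d x u = d m u" "d m x + d x v = d m v"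
    using b assms(5) by (auto simp: btw_def)
  ultimately have "d m x \<le> 0" using mdist_commute[of T u m] mdist_commute[of T u x] by linarith
  then have "d m x = 0" using mdist_nonneg[of T m x] by linarith
  then show False using x by simp
qed

lemma halfspace_open:
  assumes A: "halfspace T A" and "u \<in> A"
  obtains e where "e > 0" "\<And>v. v \<in> M \<Longrightarrow> d u v < e \<Longrightarrow> v \<in> A"
proof -
  obtain x where x: "x \<in> M" "u \<in> M" "A = side x u" using halfspace_as_side[OF A assms(2)] by metis
  have "openin (mtopology_of T) A" using openin_side(1) x by simp
  then show ?thesis using assms(2) that unfolding openin_mtopology_of by blast
qed

lemma opposite_disjoint:
  assumes "opposite T A A'" "u \<in> A"
  shows "u \<notin> A'"
proof
  assume u: "u \<in> A'"
  obtain x a b where x: "x \<in> M" "a \<in> M" "b \<in> M" "A = side x a" "A' = side x b" "A \<noteq> A'"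
    using assms(1) by (auto simp: opposite_def directions_eq_sides)
  then show False using side_eq[of a x u] side_eq[of b x u] u assms(2) by auto
qed

lemma opposite_sides:
  assumes "u \<in> M" "v \<in> M" "btw T u x v" "x \<noteq> u" "x \<noteq> v"
  shows "opposite T (side x u) (side x v)"
proof -
  have "x \<in> M" using assms by (auto simp: btw_def)
  moreover have "v \<in> side x v" "v \<notin> side x u" using assms side_self by (auto simp: side_def)
  ultimately show ?thesis
    using assms by (auto simp: opposite_def directions_eq_sides)
qed

text \<open>If the split \<open>{a,c}\<close>, \<open>{b,e}\<close> has a strictly smaller sum than the
  split \<open>{a,b}\<close>, \<open>{c,e}\<close>, then \<open>[a,c]\<close> and
  \<open>[b,e]\<close> are disjoint, and a point in the middle of the bridge between them
  separates the two pairs.\<close>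

lemma opposite_four:
  assumes M: "a \<in> M" "b \<in> M" "c \<in> M" "e \<in> M"
    and lt: "d a c + d b e < d a b + d c e"
  obtains A A' where "opposite T A A'" "a \<in> A" "c \<in> A" "b \<in> A'" "e \<in> A'"
proof -
  have "d a b + d c e \<le> max (d a c + d b e) (d a e + d b c)" by (rule four_pointD[OF M])
  then have 1: "d a c + d b e < d a e + d b c" using lt by linarith
  \<comment> \<open>The bridge is the part of \<open>[a,b]\<close> between the projections of \<open>c\<close> and
    \<open>e\<close>, whose distances from \<open>a\<close> are Gromov products; \<open>t\<close> is
    the average of these.\<close>
  define t where "t = ((d a c + d a b - d b c) / 2 + (d a e + d a b - d b e) / 2) / 2"
  have tri: "d b c \<le> d a b + d a c" "d a b \<le> d a e + d b e" "d a e \<le> d a b + d b e" "d a b \<le> d a c + d b c"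
    using mdist_triangle[OF M(2) M(1) M(3)] mdist_triangle[OF M(1) M(4) M(2)]
      mdist_triangle[OF M(1) M(2) M(4)] mdist_triangle[OF M(1) M(3) M(2)]
      mdist_commute[of T b a] mdist_commute[of T e b] mdist_commute[of T c b] by auto
  have t: "(d a c + d a b - d b c) / 2 < t" "t < (d a e + d a b - d b e) / 2"
    using 1 by (auto simp: t_def field_simps)
  then have "0 < t" "t < d a b" using tri by auto
  then obtain x where x: "btw T a x b" "d a x = t" "d x b = d a b - t"
    using geodesic_space_point[OF geo M(1,2), of t] by auto
  have xM: "x \<in> M" by (rule btw_mspace[OF x(1)])
  have ne: "x \<noteq> a" "x \<noteq> b" using x \<open>0 < t\<close> \<open>t < d a b\<close> M by auto
  have "\<not> btw T a x c"
  proof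
    assume "btw T a x c"
    then have "d a x + d x c = d a c" by (simp add: btw_def)
    moreover have "d b c \<le> d b x + d x c" by (intro mdist_triangle M xM)
    ultimately show False using x t(1) mdist_commute[of T b x] by argo
  qed
  moreover have "\<not> btw T b x e"
  proof
    assume "btw T b x e"
    then have "d b x + d x e = d b e" by (simp add: btw_def)
    moreover have "d a e \<le> d a x + d x e" by (intro mdist_triangle M xM)
    ultimately show False using x t(2) mdist_commute[of T b x] by argo
  qed
  ultimately show ?thesis
    using that[OF opposite_sides[OF M(1,2) x(1) ne]] side_self ne M by (auto simp: side_def)
qed

text \<open>Each of the two pairs \<open>p, p'\<close> and \<open>q, q'\<close> lies between the other, as
  for the corners of a rectangle in the plane with the \<open>l1\<close> metric. A tree contains
  no rectangle with four nondegenerate sides, and \<open>[p,q]\<close> is nondegenerate, so the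
  sides \<open>[q,p']\<close> and \<open>[p,q']\<close> have length zero.\<close>

lemma btw_quadrilateral:
  assumes M: "p \<in> M" "q \<in> M" "p' \<in> M" "q' \<in> M"
    and b: "btw T p q p'" "btw T q p q'" "btw T p' q' p" "btw T q' p' q" and ne: "p \<noteq> q"
  shows "q = p'" "p = q'"
proof -
  have e: "d p q + d q p' = d p p'" "d p q + d p q' = d q q'" "d p' q' + d p q' = d p p'"
    "d p' q' + d q p' = d q q'"
    using b mdist_commute[of T p' p] mdist_commute[of T q' q] mdist_commute[of T q p]
      mdist_commute[of T q' p'] mdist_commute[of T p' q] mdist_commute[of T q' p] by (auto simp: btw_def)
  then have e2: "d q p' = d p q'" "d p q = d p' q'" by linarith+
  have "d p p' + d q q' \<le> max (d p q + d p' q') (d p q' + d p' q)"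
    by (rule four_pointD[OF M(1,3,2,4)])
  moreover have "d p q > 0" using ne M mdist_nonneg[of T p q] by (simp add: order_less_le)
  ultimately have "d q p' \<le> 0" using e e2 mdist_commute[of T p' q] by linarith
  then have "d q p' = 0" "d p q' = 0" using mdist_nonneg[of T q p'] e2 by linarith+
  then show "q = p'" "p = q'" using M by simp_all
qed

end

section \<open>Crossing sets, hulls and gaps\<close>

locale two_trees = T1: rtree T1 + T2: rtree T2
  for T1 :: "'a metric" and T2 :: "'b metric"
begin

abbreviation "P \<equiv> mspace T1 \<times> mspace T2"

definition crosses :: "('a \<times> 'b) set \<Rightarrow> bool" where
  "crosses X \<longleftrightarrow> (\<exists>A A' B B'. opposite T1 A A' \<and> opposite T2 B B' \<and>
     X \<inter> A \<times> B \<noteq> {} \<and> X \<inter> A \<times> B' \<noteq> {} \<and> X \<inter> A' \<times> B \<noteq> {} \<and> X \<inter> A' \<times> B' \<noteq> {})"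

lemma coords_in:
  assumes "X \<subseteq> P" "r \<in> X"
  shows "fst r \<in> mspace T1" "snd r \<in> mspace T2"
  using assms by auto

lemma crossesI:
  assumes "opposite T1 A A'" "opposite T2 B B'"
    and "X \<inter> A \<times> B \<noteq> {}" "X \<inter> A \<times> B' \<noteq> {}" "X \<inter> A' \<times> B \<noteq> {}" "X \<inter> A' \<times> B' \<noteq> {}"
  shows "crosses X"
  unfolding crosses_def using assms by (intro exI conjI)

lemma crossesE:
  assumes "crosses X"
  obtains A A' B B' where "opposite T1 A A'" "opposite T2 B B'"
    "X \<inter> A \<times> B \<noteq> {}" "X \<inter> A \<times> B' \<noteq> {}" "X \<inter> A' \<times> B \<noteq> {}" "X \<inter> A' \<times> B' \<noteq> {}"
  using assms unfolding crosses_def by (elim exE conjE) (rule that)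

text \<open>Coordinatewise betweenness. It is betweenness for the sum of the two metrics
  (\<open>btw_sum_metric\<close>).\<close>

definition cbtw :: "'a \<times> 'b \<Rightarrow> 'a \<times> 'b \<Rightarrow> 'a \<times> 'b \<Rightarrow> bool" where
  "cbtw p r q \<longleftrightarrow> btw T1 (fst p) (fst r) (fst q) \<and> btw T2 (snd p) (snd r) (snd q)"

text \<open>The points that no quadrant separates from \<open>X\<close>. This contains the limits of
  monotone sequences and the medians of points of \<open>X\<close>.\<close>

definition quadrant_hull :: "('a \<times> 'b) set \<Rightarrow> ('a \<times> 'b) set" where
  "quadrant_hull X = {z \<in> P. \<forall>A B. halfspace T1 A \<longrightarrow> halfspace T2 B \<longrightarrow> z \<in> A \<times> B \<longrightarrow> X \<inter> A \<times> B \<noteq> {}}"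

definition gap :: "('a \<times> 'b) set \<Rightarrow> 'a \<times> 'b \<Rightarrow> 'a \<times> 'b \<Rightarrow> bool" where
  "gap X p q \<longleftrightarrow> p \<in> X \<and> q \<in> X \<and> p \<noteq> q \<and> (\<forall>r\<in>X. cbtw p r q \<longrightarrow> r = p \<or> r = q)"

definition midpoint_of :: "'a \<times> 'b \<Rightarrow> 'a \<times> 'b \<Rightarrow> 'a \<times> 'b \<Rightarrow> bool" where
  "midpoint_of m p q \<longleftrightarrow> cbtw p m q \<and>
     mdist T1 (fst p) (fst m) = mdist T1 (fst p) (fst q) / 2 \<and>
     mdist T2 (snd p) (snd m) = mdist T2 (snd p) (snd q) / 2"

definition fill_gaps :: "('a \<times> 'b) set \<Rightarrow> ('a \<times> 'b) set" where
  "fill_gaps X = X \<union> {m. \<exists>p q. gap X p q \<and> midpoint_of m p q}"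

lemma cbtw_commute: "cbtw p r q \<longleftrightarrow> cbtw q r p"
  by (auto simp: cbtw_def btw_commute)

lemma gap_sym: "gap X p q \<Longrightarrow> gap X q p"
  using cbtw_commute by (auto simp: gap_def)

lemma midpoint_of_sym: "midpoint_of m p q \<Longrightarrow> midpoint_of m q p"
  by (auto simp: midpoint_of_def cbtw_def btw_def mdist_commute)

lemma quadrant_hull_superset: "X \<subseteq> P \<Longrightarrow> X \<subseteq> quadrant_hull X"
  by (auto simp: quadrant_hull_def)

lemma crosses_quadrant_hull: "crosses (quadrant_hull X) \<Longrightarrow> crosses X"
proof -
  have meets: "X \<inter> A \<times> B \<noteq> {}"
    if "quadrant_hull X \<inter> A \<times> B \<noteq> {}" "halfspace T1 A" "halfspace T2 B" for A B
    using that unfolding quadrant_hull_def by fast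
  assume "crosses (quadrant_hull X)"
  then obtain A A' B B' where AB: "opposite T1 A A'" "opposite T2 B B'"
    and ne: "quadrant_hull X \<inter> A \<times> B \<noteq> {}" "quadrant_hull X \<inter> A \<times> B' \<noteq> {}"
      "quadrant_hull X \<inter> A' \<times> B \<noteq> {}" "quadrant_hull X \<inter> A' \<times> B' \<noteq> {}"
    by (rule crossesE)
  note H = opposite_halfspace[OF AB(1)] opposite_halfspace[OF AB(2)]
  show "crosses X"
    using crossesI AB meets[OF ne(1) H(1,3)] meets[OF ne(2) H(1,4)] meets[OF ne(3) H(2,3)] meets[OF ne(4) H(2,4)]
    by metis
qed

text \<open>A half-space that contains a median contains two of the three points. For a quadrant this gives
  two of the first coordinates and two of the second ones, hence one point with both coordinates.\<close>

lemma median_in_quadrant_hull: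
  assumes X: "X \<subseteq> P" and pqr: "p \<in> X" "q \<in> X" "r \<in> X"
    and m: "cbtw p m q" "cbtw q m r" "cbtw p m r"
  shows "m \<in> quadrant_hull X"
  unfolding quadrant_hull_def
proof (intro CollectI conjI allI impI)
  show "m \<in> P" using m by (auto simp: cbtw_def btw_def mem_Times_iff)
  fix A B assume A: "halfspace T1 A" and B: "halfspace T2 B" and mAB: "m \<in> A \<times> B"
  have M: "fst p \<in> mspace T1" "fst q \<in> mspace T1" "fst r \<in> mspace T1"
    "snd p \<in> mspace T2" "snd q \<in> mspace T2" "snd r \<in> mspace T2"
    using coords_in[OF X] pqr by blast+
  have mA: "fst m \<in> A" "snd m \<in> B" using mAB by (auto simp: mem_Times_iff)
  have "fst p \<in> A \<or> fst q \<in> A" "fst q \<in> A \<or> fst r \<in> A" "fst p \<in> A \<or> fst r \<in> A"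
    using T1.halfspace_coconvex[OF A _ _ mA(1)] M m by (auto simp: cbtw_def)
  moreover have "snd p \<in> B \<or> snd q \<in> B" "snd q \<in> B \<or> snd r \<in> B" "snd p \<in> B \<or> snd r \<in> B"
    using T2.halfspace_coconvex[OF B _ _ mA(2)] M m by (auto simp: cbtw_def)
  ultimately have "p \<in> A \<times> B \<or> q \<in> A \<times> B \<or> r \<in> A \<times> B" by (auto simp: mem_Times_iff)
  then show "X \<inter> A \<times> B \<noteq> {}" using pqr by blast
qed

text \<open>The median of \<open>p\<close>, \<open>q\<close>, \<open>r\<close> belongs to \<open>X\<close>
  and lies between \<open>p\<close> and \<open>q\<close>, so it is one of these.\<close>

lemma gap_side:
  assumes X: "X \<subseteq> P" "quadrant_hull X \<subseteq> X" and g: "gap X p q" and r: "r \<in> X"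
  shows "cbtw q p r \<or> cbtw p q r"
proof -
  have pq: "p \<in> X" "q \<in> X" using g by (auto simp: gap_def)
  have M: "fst p \<in> mspace T1" "fst q \<in> mspace T1" "fst r \<in> mspace T1"
    "snd p \<in> mspace T2" "snd q \<in> mspace T2" "snd r \<in> mspace T2"
    using coords_in[OF X(1)] pq r by blast+
  obtain m1 where m1: "btw T1 (fst p) m1 (fst q)" "btw T1 (fst q) m1 (fst r)" "btw T1 (fst p) m1 (fst r)"
    using T1.median[OF M(1-3)] .
  obtain m2 where m2: "btw T2 (snd p) m2 (snd q)" "btw T2 (snd q) m2 (snd r)" "btw T2 (snd p) m2 (snd r)"
    using T2.median[OF M(4-6)] .
  have c: "cbtw p (m1, m2) q" "cbtw q (m1, m2) r" "cbtw p (m1, m2) r"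
    using m1 m2 by (auto simp: cbtw_def)
  then have "(m1, m2) \<in> X" using median_in_quadrant_hull[OF X(1) pq r c] X(2) by blast
  then have "(m1, m2) = p \<or> (m1, m2) = q" using g c(1) by (auto simp: gap_def)
  then show ?thesis using c by auto
qed

text \<open>A quadrant that meets the filling but not \<open>X\<close> is cut diagonally by a gap: one end
  has only its first coordinate in the quadrant, and the other end only its second one.\<close>

lemma fill_gaps_quadrant:
  assumes X: "X \<subseteq> P" and A: "halfspace T1 A" and B: "halfspace T2 B"
    and u: "u \<in> fill_gaps X" "u \<in> A \<times> B" and miss: "X \<inter> A \<times> B = {}"
  obtains p q where "gap X p q" "midpoint_of u p q" "fst p \<in> A" "snd p \<notin> B" "fst q \<notin> A" "snd q \<in> B"
proof -
  obtain p q where g: "gap X p q" and m: "midpoint_of u p q"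
    using u miss by (auto simp: fill_gaps_def)
  have pq: "p \<in> X" "q \<in> X" using g by (auto simp: gap_def)
  then have n: "p \<notin> A \<times> B" "q \<notin> A \<times> B" using miss by auto
  have "fst p \<in> A \<or> fst q \<in> A" "snd p \<in> B \<or> snd q \<in> B"
    using T1.halfspace_coconvex[OF A, of "fst p" "fst q" "fst u"]
      T2.halfspace_coconvex[OF B, of "snd p" "snd q" "snd u"] m coords_in[OF X] pq u
    by (auto simp: midpoint_of_def cbtw_def mem_Times_iff)
  then have "(fst p \<in> A \<and> snd p \<notin> B \<and> fst q \<notin> A \<and> snd q \<in> B) \<or>
      (fst q \<in> A \<and> snd q \<notin> B \<and> fst p \<notin> A \<and> snd p \<in> B)"
    using n by (auto simp: mem_Times_iff)
  then show ?thesis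
    using that[of p q] that[of q p] g m gap_sym midpoint_of_sym by blast
qed

text \<open>Two midpoints of gaps cannot lie in opposite quadrants that miss \<open>X\<close>. Each of the
  two quadrants is cut diagonally by its gap, \<open>(p,q)\<close> or \<open>(p',q')\<close>. By
  \<open>gap_side\<close>, each end of a gap lies between the other end and an end of the other
  gap, as in \<open>btw_quadrilateral\<close>, and this forces the two gaps to coincide up to
  orientation. Then the midpoints coincide, although they lie in disjoint quadrants.\<close>

lemma fill_gaps_opposite_quadrants:
  assumes X: "X \<subseteq> P" "quadrant_hull X \<subseteq> X" and AA: "opposite T1 A A'" and BB: "opposite T2 B B'"
    and miss: "X \<inter> A \<times> B = {}" and u: "fill_gaps X \<inter> A \<times> B \<noteq> {}" and u': "fill_gaps X \<inter> A' \<times> B' \<noteq> {}"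
  shows False
proof -
  note H = opposite_halfspace[OF AA] opposite_halfspace[OF BB]
  have dA: "a \<notin> A" if "a \<in> A'" for a using T1.opposite_disjoint[OF AA] that by blast
  have dB: "b \<notin> B" if "b \<in> B'" for b using T2.opposite_disjoint[OF BB] that by blast
  have M: "fst r \<in> mspace T1" "snd r \<in> mspace T2" if "r \<in> X" for r
    using coords_in[OF X(1) that] by blast+
  obtain z where z: "z \<in> fill_gaps X" "z \<in> A \<times> B" using u by blast
  obtain p q where g: "gap X p q" and mz: "midpoint_of z p q"
    and pq: "fst p \<in> A" "snd p \<notin> B" "fst q \<notin> A" "snd q \<in> B"
    using fill_gaps_quadrant[OF X(1) H(1,3) z miss] .
  have pX: "p \<in> X" "q \<in> X" using g by (auto simp: gap_def)
  have notp: "\<not> cbtw q p r" if "r \<in> X" "fst r \<notin> A" for r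
    using T1.halfspace_coconvex[OF H(1), of "fst q" "fst r" "fst p"] M[OF that(1)] M[OF pX(2)] pq that
    by (auto simp: cbtw_def)
  have notq: "\<not> cbtw p q r" if "r \<in> X" "snd r \<notin> B" for r
    using T2.halfspace_coconvex[OF H(3), of "snd p" "snd r" "snd q"] M[OF that(1)] M[OF pX(1)] pq that
    by (auto simp: cbtw_def)
  have miss': "X \<inter> A' \<times> B' = {}"
  proof (rule ccontr)
    assume "X \<inter> A' \<times> B' \<noteq> {}"
    then obtain r where r: "r \<in> X" "fst r \<in> A'" "snd r \<in> B'" by auto
    then show False using gap_side[OF X g r(1)] notp[of r] notq[of r] dA dB by blast
  qed
  obtain z' where z': "z' \<in> fill_gaps X" "z' \<in> A' \<times> B'" using u' by blast
  obtain p' q' where g': "gap X p' q'" and mz': "midpoint_of z' p' q'"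
    and pq': "fst p' \<in> A'" "snd p' \<notin> B'" "fst q' \<notin> A'" "snd q' \<in> B'"
    using fill_gaps_quadrant[OF X(1) H(2,4) z' miss'] .
  have pX': "p' \<in> X" "q' \<in> X" using g' by (auto simp: gap_def)
  have notp': "\<not> cbtw q' p' r" if "r \<in> X" "fst r \<notin> A'" for r
    using T1.halfspace_coconvex[OF H(2), of "fst q'" "fst r" "fst p'"] M[OF that(1)] M[OF pX'(2)] pq' that
    by (auto simp: cbtw_def)
  have notq': "\<not> cbtw p' q' r" if "r \<in> X" "snd r \<notin> B'" for r
    using T2.halfspace_coconvex[OF H(4), of "snd p'" "snd r" "snd q'"] M[OF that(1)] M[OF pX'(1)] pq' that
    by (auto simp: cbtw_def)
  have c: "cbtw p q p'" "cbtw q p q'" "cbtw p' q' p" "cbtw q' p' q"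
    using gap_side[OF X g pX'(1)] gap_side[OF X g pX'(2)] gap_side[OF X g' pX(1)] gap_side[OF X g' pX(2)]
      notp[OF pX'(1)] notq[OF pX'(2)] notp'[OF pX(1)] notq'[OF pX(2)] pq pq' dA dB by blast+
  have "fst p \<noteq> fst q" "snd p \<noteq> snd q" using pq by auto
  then have "fst q = fst p'" "fst p = fst q'" "snd q = snd p'" "snd p = snd q'"
    using T1.btw_quadrilateral[of "fst p" "fst q" "fst p'" "fst q'"]
      T2.btw_quadrilateral[of "snd p" "snd q" "snd p'" "snd q'"] c M pX pX' by (auto simp: cbtw_def)
  then have "q = p'" "p = q'" by (simp_all add: prod_eq_iff)
  then have "midpoint_of z' p q" using midpoint_of_sym[OF mz'] by simp
  then have "fst z' = fst z"
    using T1.btw_unique[of "fst p" "fst q" "fst z'" "fst z"] mz M pX by (auto simp: midpoint_of_def cbtw_def)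
  then show False using z z' dA by (auto simp: mem_Times_iff)
qed

text \<open>If a quadrant of a crossing of the filling misses \<open>X\<close>, then it and the opposite
  quadrant contradict \<open>fill_gaps_opposite_quadrants\<close>. So \<open>X\<close> meets all
  four.\<close>

lemma crosses_fill_gaps:
  assumes X: "X \<subseteq> P" "quadrant_hull X \<subseteq> X" and cr: "crosses (fill_gaps X)"
  shows "crosses X"
proof -
  obtain A A' B B' where AB: "opposite T1 A A'" "opposite T2 B B'" and
    ne: "fill_gaps X \<inter> A \<times> B \<noteq> {}" "fill_gaps X \<inter> A \<times> B' \<noteq> {}"
      "fill_gaps X \<inter> A' \<times> B \<noteq> {}" "fill_gaps X \<inter> A' \<times> B' \<noteq> {}"
    using cr by (rule crossesE)
  note F = fill_gaps_opposite_quadrants[OF X]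
  have "X \<inter> A \<times> B \<noteq> {}" "X \<inter> A \<times> B' \<noteq> {}" "X \<inter> A' \<times> B \<noteq> {}" "X \<inter> A' \<times> B' \<noteq> {}"
    using F[OF AB _ ne(1,4)] F[OF AB(1) opposite_sym[OF AB(2)] _ ne(2,3)]
      F[OF opposite_sym[OF AB(1)] AB(2) _ ne(3,2)] F[OF opposite_sym[OF AB(1)] opposite_sym[OF AB(2)] _ ne(4,1)]
    by blast+
  then show ?thesis by (rule crossesI[OF AB])
qed

end

section \<open>Noncrossing sets are trees for the sum metric\<close>

lemma (in rtree) convex_imp_subtree:
  assumes S: "S \<subseteq> M" "S \<noteq> {}" and conv: "\<And>u v x. u \<in> S \<Longrightarrow> v \<in> S \<Longrightarrow> btw T u x v \<Longrightarrow> x \<in> S"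
  shows "subtree T S"
proof -
  have SM: "S \<inter> M = S" using S by auto
  have "geodesic_space (submetric T S)"
    unfolding geodesic_space_def
  proof (intro ballI)
    fix u v assume "u \<in> mspace (submetric T S)" "v \<in> mspace (submetric T S)"
    then have uv: "u \<in> S" "v \<in> S" "u \<in> M" "v \<in> M" by auto
    obtain c where c: "geodesic T u v c" using geo uv unfolding geodesic_space_def by blast
    have "c t \<in> S" if "t \<in> {0..d u v}" for t
      using conv[OF uv(1,2) geodesic_btw(1)[OF c]] that by simp
    then have "geodesic (submetric T S) u v c"
      using c by (auto simp: geodesic_def SM)
    then show "\<exists>c. geodesic (submetric T S) u v c" by blast
  qed
  moreover have "four_point (submetric T S)" using fp by (simp add: four_point_def)
  ultimately show ?thesis
    using rtree_imp_real_tree[of "submetric T S"] S SM by (simp add: subtree_def)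
qed

text \<open>Since a point of \<open>[u,v]\<close> separates \<open>u\<close> from \<open>v\<close>, every
  connected set through \<open>u\<close> and \<open>v\<close> contains \<open>[u,v]\<close>. So
  the image of a geodesic space is convex.\<close>

lemma (in rtree) continuous_image_subtree:
  assumes S: "geodesic_space S" "mspace S \<noteq> {}"
    and f: "continuous_map (mtopology_of S) (mtopology_of T) f"
  shows "subtree T (f ` mspace S)"
proof (rule convex_imp_subtree)
  show sub: "f ` mspace S \<subseteq> M" using continuous_map_image_subset_topspace[OF f] by simp
  show "f ` mspace S \<noteq> {}" using S by simp
  fix u v x assume u: "u \<in> f ` mspace S" and v: "v \<in> f ` mspace S" and x: "btw T u x v"
  obtain p q where p: "p \<in> mspace S" "u = f p" and q: "q \<in> mspace S" "v = f q"
    using u v by blast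
  obtain c where c: "geodesic S p q c" using S(1) p q unfolding geodesic_space_def by blast
  define K where "K = f ` c ` {0..mdist S p q}"
  have "connectedin (mtopology_of T) K"
    unfolding K_def
    by (intro connectedin_continuous_map_image[OF f] connectedin_continuous_map_image[OF geodesic_continuous[OF c]])
      (simp add: connectedin_absolute)
  moreover have "u \<in> K" "v \<in> K"
    unfolding K_def p(2) q(2) using geodesicD(1,2)[OF c]
    by (auto intro!: image_eqI[of _ f] image_eqI[of p c 0] image_eqI[of q c "mdist S p q"])
  ultimately have "x \<in> K"
    using connected_avoiding_same_side[of K u v x] x btw_mspace[OF x] by blast
  then show "x \<in> f ` mspace S" using geodesicD(3)[OF c] by (auto simp: K_def)
qed

context two_trees
begin

definition sum_dist :: "'a \<times> 'b \<Rightarrow> 'a \<times> 'b \<Rightarrow> real" where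
  "sum_dist p q = mdist T1 (fst p) (fst q) + mdist T2 (snd p) (snd q)"

definition sum_metric :: "('a \<times> 'b) set \<Rightarrow> ('a \<times> 'b) metric" where
  "sum_metric X = metric (X, sum_dist)"

lemma Metric_space_sum_dist:
  assumes X: "X \<subseteq> P"
  shows "Metric_space X sum_dist"
proof
  show "0 \<le> sum_dist p q" for p q by (simp add: sum_dist_def)
  show "sum_dist p q = sum_dist q p" for p q by (simp add: sum_dist_def mdist_commute)
  show "sum_dist p q = 0 \<longleftrightarrow> p = q" if "p \<in> X" "q \<in> X" for p q
    using coords_in[OF X that(1)] coords_in[OF X that(2)]
    by (simp add: sum_dist_def add_nonneg_eq_0_iff prod_eq_iff)
  show "sum_dist p r \<le> sum_dist p q + sum_dist q r" if "p \<in> X" "q \<in> X" "r \<in> X" for p q r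
    using mdist_triangle[OF coords_in(1)[OF X that(1)] coords_in(1)[OF X that(2)] coords_in(1)[OF X that(3)]]
      mdist_triangle[OF coords_in(2)[OF X that(1)] coords_in(2)[OF X that(2)] coords_in(2)[OF X that(3)]]
    unfolding sum_dist_def by linarith
qed

lemma sum_metric_simps [simp]:
  assumes "X \<subseteq> P"
  shows "mspace (sum_metric X) = X" "mdist (sum_metric X) = sum_dist"
  using Metric_space.mspace_metric[OF Metric_space_sum_dist[OF assms]]
    Metric_space.mdist_metric[OF Metric_space_sum_dist[OF assms]]
  by (simp_all add: sum_metric_def)

lemma btw_sum_metric:
  assumes X: "X \<subseteq> P" and "p \<in> X" "q \<in> X" "r \<in> X"
  shows "btw (sum_metric X) p r q \<longleftrightarrow> cbtw p r q"
proof -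
  note M = coords_in[OF X assms(2)] coords_in[OF X assms(3)] coords_in[OF X assms(4)]
  have "mdist T1 (fst p) (fst q) \<le> mdist T1 (fst p) (fst r) + mdist T1 (fst r) (fst q)"
    "mdist T2 (snd p) (snd q) \<le> mdist T2 (snd p) (snd r) + mdist T2 (snd r) (snd q)"
    using M by (auto intro: mdist_triangle)
  then show ?thesis
    using assms M by (auto simp: btw_def cbtw_def sum_dist_def)
qed

text \<open>The points of a noncrossing set between \<open>u\<close> and \<open>v\<close> form a chain for
  the product order: if \<open>r\<close> came strictly before \<open>s\<close> in
  \<open>T1\<close> and strictly after it in \<open>T2\<close>, then \<open>u, r, s, v\<close>
  would cross.\<close>

lemma chain_comparable:
  assumes X: "X \<subseteq> P" and nc: "\<not> crosses X"
    and uv: "u \<in> X" "v \<in> X" and r: "r \<in> X" "cbtw u r v" and s: "s \<in> X" "cbtw u s v"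
    and lt: "mdist T1 (fst u) (fst r) < mdist T1 (fst u) (fst s)"
  shows "mdist T2 (snd u) (snd r) \<le> mdist T2 (snd u) (snd s)"
proof (rule ccontr)
  assume n: "\<not> ?thesis"
  note M = coords_in[OF X uv(1)] coords_in[OF X uv(2)] coords_in[OF X r(1)] coords_in[OF X s(1)]
  have e: "mdist T1 (fst u) (fst r) + mdist T1 (fst r) (fst v) = mdist T1 (fst u) (fst v)"
    "mdist T1 (fst u) (fst s) + mdist T1 (fst s) (fst v) = mdist T1 (fst u) (fst v)"
    "mdist T2 (snd u) (snd r) + mdist T2 (snd r) (snd v) = mdist T2 (snd u) (snd v)"
    "mdist T2 (snd u) (snd s) + mdist T2 (snd s) (snd v) = mdist T2 (snd u) (snd v)"
    using r(2) s(2) by (auto simp: cbtw_def btw_def)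
  have lt1: "mdist T1 (fst u) (fst r) + mdist T1 (fst s) (fst v) <
      mdist T1 (fst u) (fst s) + mdist T1 (fst r) (fst v)" using e lt by linarith
  have lt2: "mdist T2 (snd u) (snd s) + mdist T2 (snd r) (snd v) <
      mdist T2 (snd u) (snd r) + mdist T2 (snd s) (snd v)" using e n by linarith
  obtain A A' where A: "opposite T1 A A'" "fst u \<in> A" "fst r \<in> A" "fst s \<in> A'" "fst v \<in> A'"
    using T1.opposite_four[OF M(1,7,5,3) lt1] .
  obtain B B' where B: "opposite T2 B B'" "snd u \<in> B" "snd s \<in> B" "snd r \<in> B'" "snd v \<in> B'"
    using T2.opposite_four[OF M(2,6,8,4) lt2] .
  have "u \<in> X \<inter> A \<times> B" "r \<in> X \<inter> A \<times> B'" "s \<in> X \<inter> A' \<times> B" "v \<in> X \<inter> A' \<times> B'"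
    using A B uv r s by (auto simp: mem_Times_iff)
  then have "crosses X" by (intro crossesI[OF A(1) B(1)]) blast+
  then show False using nc by blast
qed

lemma cbtw_ends: "u \<in> P \<Longrightarrow> v \<in> P \<Longrightarrow> cbtw u u v \<and> cbtw u v v"
  by (auto simp: cbtw_def)

text \<open>The coordinates of the points between \<open>u\<close> and \<open>v\<close> at distance at most
  \<open>t\<close> from \<open>u\<close> have suprema \<open>\<alpha>\<close> and
  \<open>\<beta>\<close>. Because these points form a chain, some of them approach both suprema
  simultaneously, so the point with coordinates \<open>(\<alpha>,\<beta>)\<close> is in the hull.\<close>

lemma last_point_before:
  assumes X: "X \<subseteq> P" and nc: "\<not> crosses X" and closed: "quadrant_hull X \<subseteq> X"
    and uv: "u \<in> X" "v \<in> X" and t: "0 \<le> t"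
  obtains z where "z \<in> X" "cbtw u z v" "sum_dist u z \<le> t"
    "\<And>r. r \<in> X \<Longrightarrow> cbtw u r v \<Longrightarrow> sum_dist u r \<le> t \<Longrightarrow> sum_dist u r \<le> sum_dist u z"
proof -
  define a where "a r = mdist T1 (fst u) (fst r)" for r :: "'a \<times> 'b"
  define b where "b r = mdist T2 (snd u) (snd r)" for r :: "'a \<times> 'b"
  define R where "R = {r \<in> X. cbtw u r v \<and> sum_dist u r \<le> t}"
  have D: "sum_dist u r = a r + b r" for r by (simp add: sum_dist_def a_def b_def)
  note M = coords_in[OF X uv(1)] coords_in[OF X uv(2)]
  have u: "u \<in> R" using uv t X cbtw_ends M by (auto simp: R_def sum_dist_def cbtw_def)
  have le: "a r \<le> a v" "b r \<le> b v" if "r \<in> R" for r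
    using that btw_le(1) by (auto simp: R_def cbtw_def a_def b_def)
  have bdd: "bdd_above (a ` R)" "bdd_above (b ` R)" using le by (auto intro!: bdd_aboveI2)
  define \<alpha> where "\<alpha> = Sup (a ` R)"
  define \<beta> where "\<beta> = Sup (b ` R)"
  have ub: "a r \<le> \<alpha>" "b r \<le> \<beta>" if "r \<in> R" for r
    unfolding \<alpha>_def \<beta>_def using that bdd by (auto intro!: cSup_upper)
  have "\<alpha> \<le> a v" "\<beta> \<le> b v"
    unfolding \<alpha>_def \<beta>_def using le u by (auto intro!: cSup_least)
  moreover have "0 \<le> \<alpha>" "0 \<le> \<beta>" using ub[OF u] M by (auto simp: a_def b_def)
  ultimately obtain z1 z2 where z: "btw T1 (fst u) z1 (fst v)" "mdist T1 (fst u) z1 = \<alpha>"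
      "btw T2 (snd u) z2 (snd v)" "mdist T2 (snd u) z2 = \<beta>"
    using geodesic_space_point[OF T1.geo M(1,3)] geodesic_space_point[OF T2.geo M(2,4)]
    unfolding a_def b_def by metis
  have approx: "\<exists>r\<in>R. \<alpha> - e < a r \<and> \<beta> - e < b r" if "e > 0" for e
  proof -
    have ne: "a ` R \<noteq> {}" "b ` R \<noteq> {}" using u by auto
    obtain r where r: "r \<in> R" "\<alpha> - e < a r"
      using less_cSupD[OF ne(1), of "\<alpha> - e"] \<open>e > 0\<close> by (auto simp flip: \<alpha>_def)
    obtain s where s: "s \<in> R" "\<beta> - e < b s"
      using less_cSupD[OF ne(2), of "\<beta> - e"] \<open>e > 0\<close> by (auto simp flip: \<beta>_def)
    show ?thesis
    proof (cases "a r \<le> a s")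
      case True
      then show ?thesis using r s by (intro bexI[of _ s]) auto
    next
      case False
      then have "b s \<le> b r"
        using chain_comparable[OF X nc uv, of s r] r s by (auto simp: R_def a_def b_def)
      then show ?thesis using r s by (intro bexI[of _ r]) auto
    qed
  qed
  have "\<alpha> + \<beta> \<le> t"
  proof (rule ccontr)
    assume "\<not> ?thesis"
    then obtain r where "r \<in> R" "\<alpha> - (\<alpha> + \<beta> - t) / 2 < a r" "\<beta> - (\<alpha> + \<beta> - t) / 2 < b r"
      using approx[of "(\<alpha> + \<beta> - t) / 2"] by auto
    then show False using D[of r] by (auto simp: R_def field_simps)
  qed
  have "(z1, z2) \<in> quadrant_hull X"
    unfolding quadrant_hull_def
  proof (intro CollectI conjI allI impI)
    show "(z1, z2) \<in> P" using z by (auto simp: btw_def)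
    fix A B assume A: "halfspace T1 A" and B: "halfspace T2 B" and "(z1, z2) \<in> A \<times> B"
    then have zz: "z1 \<in> A" "z2 \<in> B" by auto
    obtain e1 where e1: "e1 > 0" "\<And>v. v \<in> mspace T1 \<Longrightarrow> mdist T1 z1 v < e1 \<Longrightarrow> v \<in> A"
      using T1.halfspace_open[OF A zz(1)] by blast
    obtain e2 where e2: "e2 > 0" "\<And>v. v \<in> mspace T2 \<Longrightarrow> mdist T2 z2 v < e2 \<Longrightarrow> v \<in> B"
      using T2.halfspace_open[OF B zz(2)] by blast
    obtain r where r: "r \<in> R" "\<alpha> - min e1 e2 < a r" "\<beta> - min e1 e2 < b r"
      using approx[of "min e1 e2"] e1 e2 by auto
    have rX: "r \<in> X" "cbtw u r v" using r by (auto simp: R_def)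
    have "mdist T1 z1 (fst r) = \<alpha> - a r" "mdist T2 z2 (snd r) = \<beta> - b r"
      using T1.btw_dist[OF M(1,3) z(1), of "fst r"] T2.btw_dist[OF M(2,4) z(3), of "snd r"] rX z ub[OF r(1)]
      by (auto simp: cbtw_def a_def b_def)
    then have "fst r \<in> A" "snd r \<in> B"
      using e1(2)[of "fst r"] e2(2)[of "snd r"] coords_in[OF X rX(1)] r by auto
    then show "X \<inter> A \<times> B \<noteq> {}" using rX(1) by (auto simp: mem_Times_iff intro!: exI[of _ r])
  qed
  then have zX: "(z1, z2) \<in> X" using closed by blast
  have Dz: "sum_dist u (z1, z2) = \<alpha> + \<beta>" using z by (simp add: sum_dist_def)
  show ?thesis
  proof (rule that[OF zX])
    show "cbtw u (z1, z2) v" using z by (simp add: cbtw_def)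
    show "sum_dist u (z1, z2) \<le> t" using Dz \<open>\<alpha> + \<beta> \<le> t\<close> by simp
    show "sum_dist u r \<le> sum_dist u (z1, z2)" if "r \<in> X" "cbtw u r v" "sum_dist u r \<le> t" for r
    proof -
      have "r \<in> R" using that by (simp add: R_def)
      then show ?thesis using ub[of r] unfolding Dz D[of r] by (intro add_mono)
    qed
  qed
qed

lemma no_gaps:
  assumes X: "X \<subseteq> P" and fill: "fill_gaps X \<subseteq> X"
  shows "\<not> gap X p q"
proof
  assume g: "gap X p q"
  then have pq: "p \<in> X" "q \<in> X" "p \<noteq> q" by (auto simp: gap_def)
  note M = coords_in[OF X pq(1)] coords_in[OF X pq(2)]
  obtain m1 where m1: "btw T1 (fst p) m1 (fst q)" "mdist T1 (fst p) m1 = mdist T1 (fst p) (fst q) / 2"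
    using geodesic_space_point[OF T1.geo M(1,3), of "mdist T1 (fst p) (fst q) / 2"] by auto
  obtain m2 where m2: "btw T2 (snd p) m2 (snd q)" "mdist T2 (snd p) m2 = mdist T2 (snd p) (snd q) / 2"
    using geodesic_space_point[OF T2.geo M(2,4), of "mdist T2 (snd p) (snd q) / 2"] by auto
  have mid: "midpoint_of (m1, m2) p q" using m1 m2 by (simp add: midpoint_of_def cbtw_def)
  then have "(m1, m2) \<in> fill_gaps X" using g unfolding fill_gaps_def by blast
  then have "(m1, m2) \<in> X" using fill by blast
  then have "(m1, m2) = p \<or> (m1, m2) = q" using g mid by (auto simp: gap_def midpoint_of_def)
  then have "mdist T1 (fst p) (fst q) = 0 \<and> mdist T2 (snd p) (snd q) = 0"
    using m1 m2 M by auto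
  then show False using M pq(3) by (simp add: prod_eq_iff)
qed

end

context two_trees
begin

lemma sum_dist_cbtw:
  assumes "cbtw u r v"
  shows "sum_dist u r + sum_dist r v = sum_dist u v"
  using assms by (auto simp: cbtw_def btw_def sum_dist_def)

lemma sum_dist_nonneg: "0 \<le> sum_dist p q"
  by (simp add: sum_dist_def)

lemma sum_dist_0:
  assumes "X \<subseteq> P" "p \<in> X" "q \<in> X" "sum_dist p q \<le> 0"
  shows "p = q"
proof -
  have "mdist T1 (fst p) (fst q) = 0" "mdist T2 (snd p) (snd q) = 0"
    using assms(4) mdist_nonneg[of T1 "fst p" "fst q"] mdist_nonneg[of T2 "snd p" "snd q"]
    unfolding sum_dist_def by linarith+
  then show ?thesis using coords_in[OF assms(1,2)] coords_in[OF assms(1,3)] by (simp add: prod_eq_iff)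
qed

lemma sum_dist_sym: "sum_dist p q = sum_dist q p"
  by (simp add: sum_dist_def mdist_commute)

lemma chain_ordered:
  assumes X: "X \<subseteq> P" and nc: "\<not> crosses X"
    and uv: "u \<in> X" "v \<in> X" and r: "r \<in> X" "cbtw u r v" and s: "s \<in> X" "cbtw u s v"
    and le: "sum_dist u r \<le> sum_dist u s"
  shows "cbtw u r s" "cbtw r s v"
proof -
  note M = coords_in[OF X uv(1)] coords_in[OF X uv(2)]
  have le1: "mdist T1 (fst u) (fst r) \<le> mdist T1 (fst u) (fst s)"
    using chain_comparable[OF X nc uv s r] le unfolding sum_dist_def by linarith
  have le2: "mdist T2 (snd u) (snd r) \<le> mdist T2 (snd u) (snd s)"
  proof (cases "mdist T1 (fst u) (fst r) < mdist T1 (fst u) (fst s)")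
    case True
    then show ?thesis by (rule chain_comparable[OF X nc uv r s])
  next
    case False
    then show ?thesis using le le1 unfolding sum_dist_def by linarith
  qed
  show "cbtw u r s" "cbtw r s v"
    using T1.btw_ordered[OF M(1,3) _ _ le1] T2.btw_ordered[OF M(2,4) _ _ le2] r(2) s(2)
    by (auto simp: cbtw_def)
qed

lemma cbtw_trans:
  assumes "u \<in> P" "v \<in> P" "cbtw u x v" "cbtw u y x"
  shows "cbtw u y v" "cbtw y x v"
  using assms btw_trans[of "fst u" T1 "fst v" "fst x" "fst y"] btw_trans[of "snd u" T2 "snd v" "snd x" "snd y"]
  by (auto simp: cbtw_def)

text \<open>Otherwise the last point before distance \<open>t\<close> and the first point after it would
  bound a gap. The latter is obtained by applying \<open>last_point_before\<close> from the other
  end.\<close>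

lemma point_at_distance:
  assumes X: "X \<subseteq> P" and nc: "\<not> crosses X" and closed: "quadrant_hull X \<subseteq> X" and fill: "fill_gaps X \<subseteq> X"
    and uv: "u \<in> X" "v \<in> X" and t: "0 \<le> t" "t \<le> sum_dist u v"
  obtains r where "r \<in> X" "cbtw u r v" "sum_dist u r = t"
proof -
  have uvP: "u \<in> P" "v \<in> P" using X uv by auto
  obtain z where z: "z \<in> X" "cbtw u z v" "sum_dist u z \<le> t"
    and zmax: "\<And>r. r \<in> X \<Longrightarrow> cbtw u r v \<Longrightarrow> sum_dist u r \<le> t \<Longrightarrow> sum_dist u r \<le> sum_dist u z"
    using last_point_before[OF X nc closed uv t(1)] by blast
  obtain y where y: "y \<in> X" "cbtw v y u" "sum_dist v y \<le> sum_dist u v - t"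
    and ymin: "\<And>r. r \<in> X \<Longrightarrow> cbtw v r u \<Longrightarrow> sum_dist v r \<le> sum_dist u v - t \<Longrightarrow> sum_dist v r \<le> sum_dist v y"
    using last_point_before[OF X nc closed uv(2,1), of "sum_dist u v - t"] t by auto
  have yb: "cbtw u y v" using y(2) by (simp add: cbtw_commute)
  have dy: "sum_dist u y \<ge> t"
    using sum_dist_cbtw[OF yb] y(3) sum_dist_sym[of v y] by linarith
  have ymin': "sum_dist u y \<le> sum_dist u r" if "r \<in> X" "cbtw u r v" "sum_dist u r \<ge> t" for r
    using ymin[of r] that sum_dist_cbtw[OF that(2)] sum_dist_cbtw[OF yb] sum_dist_sym[of v]
    by (auto simp: cbtw_commute)
  have "sum_dist u z = t \<or> sum_dist u y = t"
  proof (rule ccontr)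
    assume n: "\<not> ?thesis"
    then have lt: "sum_dist u z < t" "t < sum_dist u y" using z(3) dy by auto
    note o = chain_ordered[OF X nc uv z(1,2) y(1) yb]
    have zy: "cbtw u z y" "cbtw z y v" using o lt by auto
    have "z \<noteq> y" using lt by auto
    then obtain r where r: "r \<in> X" "cbtw z r y" "r \<noteq> z" "r \<noteq> y"
      using no_gaps[OF X fill, of z y] z(1) y(1) unfolding gap_def by blast
    have zP: "z \<in> P" "y \<in> P" "r \<in> P" using X z y r by auto
    have ury: "cbtw u r y" "cbtw u z r"
      using cbtw_trans[of y u z r] zP uvP zy(1) r(2) by (auto simp: cbtw_commute)
    have urv: "cbtw u r v" using cbtw_trans(1)[OF uvP yb ury(1)] .
    have d: "sum_dist u z + sum_dist z r = sum_dist u r" "sum_dist u r + sum_dist r y = sum_dist u y"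
      using sum_dist_cbtw ury by auto
    show False
    proof (cases "sum_dist u r \<le> t")
      case True
      then have "sum_dist z r \<le> 0" using zmax[OF r(1) urv] d by linarith
      then show False using sum_dist_0[OF X z(1) r(1)] r(3) by simp
    next
      case False
      then have "sum_dist r y \<le> 0" using ymin'[OF r(1) urv] d by linarith
      then show False using sum_dist_0[OF X r(1) y(1)] r(4) by simp
    qed
  qed
  then show ?thesis using that z y yb by blast
qed

lemma geodesic_space_sum_metric:
  assumes X: "X \<subseteq> P" and nc: "\<not> crosses X" and closed: "quadrant_hull X \<subseteq> X" and fill: "fill_gaps X \<subseteq> X"
  shows "geodesic_space (sum_metric X)"
  unfolding geodesic_space_def
proof (intro ballI)
  fix u v assume "u \<in> mspace (sum_metric X)" "v \<in> mspace (sum_metric X)"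
  then have uv: "u \<in> X" "v \<in> X" using X by auto
  have "\<forall>t. \<exists>r. 0 \<le> t \<longrightarrow> t \<le> sum_dist u v \<longrightarrow> r \<in> X \<and> cbtw u r v \<and> sum_dist u r = t"
    using point_at_distance[OF assms uv] by metis
  then obtain c where c: "\<And>t. 0 \<le> t \<Longrightarrow> t \<le> sum_dist u v \<Longrightarrow> c t \<in> X \<and> cbtw u (c t) v \<and> sum_dist u (c t) = t"
    by metis
  have iso: "sum_dist (c s) (c t) = t - s" if "0 \<le> s" "s \<le> t" "t \<le> sum_dist u v" for s t
  proof -
    have "cbtw u (c s) (c t)"
      using chain_ordered(1)[OF X nc uv, of "c s" "c t"] c[of s] c[of t] that by auto
    then show ?thesis using sum_dist_cbtw c[of s] c[of t] that by fastforce
  qed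
  have "c 0 = u"
    using sum_dist_0[OF X uv(1), of "c 0"] c[of 0] sum_dist_nonneg[of u v] by auto
  moreover have "c (sum_dist u v) = v"
    using sum_dist_0[OF X _ uv(2), of "c (sum_dist u v)"] c[of "sum_dist u v"] sum_dist_nonneg[of u v]
      sum_dist_cbtw[of u "c (sum_dist u v)" v] by auto
  moreover have "sum_dist (c s) (c t) = \<bar>s - t\<bar>" if "s \<in> {0..sum_dist u v}" "t \<in> {0..sum_dist u v}" for s t
    using iso[of s t] iso[of t s] that sum_dist_sym[of "c s" "c t"] by (cases "s \<le> t") auto
  ultimately have "geodesic (sum_metric X) u v c"
    using c X by (auto simp: geodesic_def)
  then show "\<exists>c. geodesic (sum_metric X) u v c" by blast
qed

text \<open>If the sum of the metrics violates the four-point condition for the split \<open>{a,b}\<close>,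
  \<open>{c,e}\<close>, then the smallest of the three sums belongs to the split
  \<open>{a,c}\<close>, \<open>{b,e}\<close> in one tree and to \<open>{a,e}\<close>,
  \<open>{b,c}\<close> in the other. The half-spaces that separate these pairs are crossed by the
  four points.\<close>

lemma four_point_sum_metric:
  assumes X: "X \<subseteq> P" and nc: "\<not> crosses X"
  shows "four_point (sum_metric X)"
  unfolding four_point_def sum_metric_simps[OF X]
proof (intro ballI, rule ccontr)
  fix a b c e assume abce: "a \<in> X" "b \<in> X" "c \<in> X" "e \<in> X"
    and n: "\<not> sum_dist a b + sum_dist c e \<le> max (sum_dist a c + sum_dist b e) (sum_dist a e + sum_dist b c)"
  note M = coords_in[OF X abce(1)] coords_in[OF X abce(2)] coords_in[OF X abce(3)] coords_in[OF X abce(4)]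
  have nc': False if A: "opposite T1 A A'" and B: "opposite T2 B B'"
      and "a \<in> A \<times> B" "x \<in> A \<times> B'" "y \<in> A' \<times> B" "b \<in> A' \<times> B'" "x \<in> X" "y \<in> X" for A A' B B' x y
  proof -
    have "X \<inter> A \<times> B \<noteq> {}" "X \<inter> A \<times> B' \<noteq> {}" "X \<inter> A' \<times> B \<noteq> {}" "X \<inter> A' \<times> B' \<noteq> {}"
      using that(3-) abce by blast+
    then show False using crossesI[OF A B] nc by blast
  qed
  define x1 y1 z1 where "x1 = mdist T1 (fst a) (fst b) + mdist T1 (fst c) (fst e)"
    and "y1 = mdist T1 (fst a) (fst c) + mdist T1 (fst b) (fst e)"
    and "z1 = mdist T1 (fst a) (fst e) + mdist T1 (fst b) (fst c)"
  define x2 y2 z2 where "x2 = mdist T2 (snd a) (snd b) + mdist T2 (snd c) (snd e)"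
    and "y2 = mdist T2 (snd a) (snd c) + mdist T2 (snd b) (snd e)"
    and "z2 = mdist T2 (snd a) (snd e) + mdist T2 (snd b) (snd c)"
  have "x1 + x2 > y1 + y2" "x1 + x2 > z1 + z2"
    using n by (auto simp: sum_dist_def x1_def y1_def z1_def x2_def y2_def z2_def)
  moreover have "x1 \<le> max y1 z1" "x2 \<le> max y2 z2"
    using T1.four_pointD[OF M(1,3,5,7)] T2.four_pointD[OF M(2,4,6,8)]
    by (auto simp: x1_def y1_def z1_def x2_def y2_def z2_def)
  ultimately consider "y1 < x1" "z2 < x2" | "z1 < x1" "y2 < x2" by linarith
  then show False
  proof cases
    case 1
    obtain A A' where A: "opposite T1 A A'" "fst a \<in> A" "fst c \<in> A" "fst b \<in> A'" "fst e \<in> A'"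
      using T1.opposite_four[OF M(1,3,5,7)] 1(1) unfolding x1_def y1_def by blast
    have "mdist T2 (snd a) (snd e) + mdist T2 (snd b) (snd c) < mdist T2 (snd a) (snd b) + mdist T2 (snd e) (snd c)"
      using 1(2) unfolding x2_def z2_def by (simp add: mdist_commute)
    then obtain B B' where B: "opposite T2 B B'" "snd a \<in> B" "snd e \<in> B" "snd b \<in> B'" "snd c \<in> B'"
      using T2.opposite_four[OF M(2,4,8,6)] by blast
    show False using nc'[OF A(1) B(1), of c e] A B abce by (auto simp: mem_Times_iff)
  next
    case 2
    have "mdist T1 (fst a) (fst e) + mdist T1 (fst b) (fst c) < mdist T1 (fst a) (fst b) + mdist T1 (fst e) (fst c)"
      using 2(1) unfolding x1_def z1_def by (simp add: mdist_commute)
    then obtain A A' where A: "opposite T1 A A'" "fst a \<in> A" "fst e \<in> A" "fst b \<in> A'" "fst c \<in> A'"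
      using T1.opposite_four[OF M(1,3,7,5)] by blast
    obtain B B' where B: "opposite T2 B B'" "snd a \<in> B" "snd c \<in> B" "snd b \<in> B'" "snd e \<in> B'"
      using T2.opposite_four[OF M(2,4,6,8)] 2(2) unfolding x2_def y2_def by blast
    show False using nc'[OF A(1) B(1), of e c] A B abce by (auto simp: mem_Times_iff)
  qed
qed

lemma preserves_alignment_projections:
  assumes X: "X \<subseteq> P" and geo: "geodesic_space (sum_metric X)"
  shows "preserves_alignment (sum_metric X) T1 fst" "preserves_alignment (sum_metric X) T2 snd"
proof -
  have seg: "cbtw p r q" if "p \<in> X" "q \<in> X" "r \<in> X" "r \<in> segment (sum_metric X) p q" for p q r
    using that segment_eq_btw[OF geo] btw_sum_metric[OF X] X by auto
  have "Lipschitz_continuous_map (sum_metric X) T1 fst"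
    unfolding Lipschitz_continuous_map_def
  proof (intro conjI exI ballI)
    show "mdist T1 (fst p) (fst q) \<le> 1 * mdist (sum_metric X) p q" for p q
      using X by (simp add: sum_dist_def)
  qed (use X in auto)
  moreover have "fst r \<in> segment T1 (fst p) (fst q)"
    if "p \<in> X" "q \<in> X" "r \<in> X" "r \<in> segment (sum_metric X) p q" for p q r
    using seg[OF that] segment_eq_btw[OF T1.geo] coords_in[OF X that(1)] coords_in[OF X that(2)]
    by (simp add: cbtw_def)
  ultimately show "preserves_alignment (sum_metric X) T1 fst"
    using X by (auto simp: preserves_alignment_def Lipschitz_continuous_imp_continuous_map)
  have "Lipschitz_continuous_map (sum_metric X) T2 snd"
    unfolding Lipschitz_continuous_map_def
  proof (intro conjI exI ballI)
    show "mdist T2 (snd p) (snd q) \<le> 1 * mdist (sum_metric X) p q" for p q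
      using X by (simp add: sum_dist_def)
  qed (use X in auto)
  moreover have "snd r \<in> segment T2 (snd p) (snd q)"
    if "p \<in> X" "q \<in> X" "r \<in> X" "r \<in> segment (sum_metric X) p q" for p q r
    using seg[OF that] segment_eq_btw[OF T2.geo] coords_in[OF X that(1)] coords_in[OF X that(2)]
    by (simp add: cbtw_def)
  ultimately show "preserves_alignment (sum_metric X) T2 snd"
    using X by (auto simp: preserves_alignment_def Lipschitz_continuous_imp_continuous_map)
qed

end

section \<open>Invariant noncrossing sets\<close>

lemma tree_actionD:
  assumes act: "tree_action G T \<phi>" and g: "g \<in> carrier G" and x: "x \<in> mspace T"
  shows "group G" "\<phi> g x \<in> mspace T" "\<phi> (inv\<^bsub>G\<^esub> g) (\<phi> g x) = x" "\<phi> g (\<phi> (inv\<^bsub>G\<^esub> g) x) = x"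
    "y \<in> mspace T \<Longrightarrow> mdist T (\<phi> g x) (\<phi> g y) = mdist T x y"
    "h \<in> carrier G \<Longrightarrow> \<phi> (g \<otimes>\<^bsub>G\<^esub> h) x = \<phi> g (\<phi> h x)"
proof -
  have ga: "group_action G (mspace T) \<phi>" using act by (simp add: tree_action_def)
  interpret group_action G "mspace T" \<phi> by (rule ga)
  show grp: "group G" using group_hom by (simp add: group_hom_def)
  interpret group G by (rule grp)
  show gx: "\<phi> g x \<in> mspace T" using element_image[OF g x] by simp
  show "\<phi> (inv\<^bsub>G\<^esub> g) (\<phi> g x) = x" using orbit_sym_aux[OF g x refl] .
  show "\<phi> g (\<phi> (inv\<^bsub>G\<^esub> g) x) = x" using orbit_sym_aux[OF inv_closed[OF g] x refl] g by simp
  show "mdist T (\<phi> g x) (\<phi> g y) = mdist T x y" if "y \<in> mspace T"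
    using act g x that by (simp add: tree_action_def)
  show "\<phi> (g \<otimes>\<^bsub>G\<^esub> h) x = \<phi> g (\<phi> h x)" if "h \<in> carrier G"
    using composition_rule[OF x g that] .
qed

lemma btw_action:
  assumes act: "tree_action G T \<phi>" and g: "g \<in> carrier G"
    and "u \<in> mspace T" "x \<in> mspace T" "v \<in> mspace T"
  shows "btw T (\<phi> g u) (\<phi> g x) (\<phi> g v) \<longleftrightarrow> btw T u x v"
  using tree_actionD(2,5)[OF act g] assms by (simp add: btw_def)

lemma (in rtree) halfspace_preimage:
  assumes act: "tree_action G T \<phi>" and g: "g \<in> carrier G" and A: "halfspace T A"
  shows "halfspace T {v \<in> M. \<phi> g v \<in> A}"
proof -
  obtain x u where x: "x \<in> M" "u \<in> M" "u \<noteq> x" "A = side x u" using A by (rule halfspaceE)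
  have gi: "inv\<^bsub>G\<^esub> g \<in> carrier G" using tree_actionD(1)[OF act g x(1)] g by (simp add: group.inv_closed)
  let ?x = "\<phi> (inv\<^bsub>G\<^esub> g) x" and ?u = "\<phi> (inv\<^bsub>G\<^esub> g) u"
  have xu: "?x \<in> M" "?u \<in> M" "\<phi> g ?x = x" "\<phi> g ?u = u"
    using tree_actionD(2)[OF act gi] tree_actionD(4)[OF act g] x by auto
  have "?u \<noteq> ?x" using xu x(3) by auto
  moreover have "{v \<in> M. \<phi> g v \<in> A} = side ?x ?u"
    using btw_action[OF act g xu(2,1)] xu(3,4) tree_actionD(2)[OF act g] by (auto simp: x(4) side_def)
  ultimately show ?thesis using halfspace_side xu by simp
qed

text \<open>The point of \<open>[a,b]\<close> closest to \<open>c\<close> is the median of \<open>a, b,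
  c\<close>. If \<open>[c,e]\<close> missed it, then \<open>e\<close> would be separated from
  \<open>a\<close> and \<open>b\<close> by it, and the assumed inequality would put it on
  \<open>[c,e]\<close> after all.\<close>

lemma (in rtree) segments_meet:
  assumes M: "a \<in> M" "b \<in> M" "c \<in> M" "e \<in> M" and le: "d a c + d b e \<le> d a b + d c e"
  shows "\<exists>m. btw T a m b \<and> btw T c m e"
proof -
  obtain m where m: "btw T a m b" "btw T b m c" "btw T a m c" using median[OF M(1-3)] .
  have mM: "m \<in> M" by (rule btw_mspace[OF m(1)])
  have "btw T c m e"
  proof (rule ccontr)
    assume n: "\<not> btw T c m e"
    have b: "btw T b m e" using btw_cases[OF M(2,4,3) m(2)] n by (auto simp: btw_commute)
    have "d c e \<le> d c m + d m e" by (intro mdist_triangle M mM)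
    moreover have "d a m + d m b = d a b" "d a m + d m c = d a c" "d b m + d m e = d b e"
      using m b by (auto simp: btw_def)
    ultimately have "d c m + d m e = d c e"
      using le mdist_commute[of T m b] mdist_commute[of T m c] by linarith
    then show False using n mM by (simp add: btw_def)
  qed
  then show ?thesis using m by blast
qed

lemma (in rtree) four_points_segments_meet:
  assumes M: "a \<in> M" "b \<in> M" "c \<in> M" "e \<in> M"
  shows "(\<exists>m. btw T a m b \<and> btw T c m e) \<or> (\<exists>m. btw T a m c \<and> btw T b m e)"
  using segments_meet[OF M] segments_meet[OF M(1,3,2,4)]
  by (cases "d a c + d b e \<le> d a b + d c e") auto

lemma (in rtree) nondegenerate_arc_segment:
  assumes "x \<in> M" "b \<in> M" "x \<noteq> b"
  shows "nondegenerate_arc T {z. btw T x z b}"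
proof -
  obtain c where c: "geodesic T x b c" using geo assms unfolding geodesic_space_def by blast
  have pos: "d x b > 0" using assms mdist_nonneg[of T x b] by (simp add: order_less_le)
  define f where "f t = c (d x b * t)" for t
  have r: "0 \<le> d x b * t \<and> d x b * t \<le> d x b" if "t \<in> {0..1}" for t
    using that pos by (auto simp: mult_left_le)
  have "continuous_map (top_of_set {0..1}) (mtopology_of T) f"
  proof (rule Lipschitz_real_continuous_map[of _ _ _ "d x b"])
    show "f s \<in> M" if "s \<in> {0..1}" for s using r[OF that] geodesicD(3)[OF c] by (simp add: f_def)
    show "d (f s) (f t) \<le> d x b * (t - s)" if "s \<in> {0..1}" "t \<in> {0..1}" "s \<le> t" for s t
    proof -
      have "d (f s) (f t) = \<bar>d x b * s - d x b * t\<bar>"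
        using geodesicD(4)[OF c] r[OF that(1)] r[OF that(2)] by (simp add: f_def)
      also have "\<dots> = \<bar>d x b * (s - t)\<bar>" by (simp add: algebra_simps)
      also have "\<dots> = d x b * (t - s)" using that pos by (simp add: abs_mult)
      finally show ?thesis by simp
    qed
  qed
  moreover have "inj_on f {0..1}"
  proof (rule inj_onI)
    fix s t :: real assume st: "s \<in> {0..1}" "t \<in> {0..1}" "f s = f t"
    have "d x b * s = d x b * t"
      using r[OF st(1)] r[OF st(2)] st(3) by (intro geodesic_inj[OF c]) (auto simp: f_def)
    then show "s = t" using pos by simp
  qed
  ultimately have "embedding_map (top_of_set {0..1}) (mtopology_of T) f"
    by (intro continuous_imp_embedding_map Hausdorff_mtopology_of)
      (simp_all add: compact_space_subtopology)
  moreover have "{z. btw T x z b} = f ` {0..1}"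
  proof (intro equalityI subsetI)
    fix z assume "z \<in> {z. btw T x z b}"
    then have z: "btw T x z b" by simp
    have le: "0 \<le> d x z" "d x z \<le> d x b" using btw_le(1)[OF z] by auto
    have "c (d x z) = z"
      using btw_unique[OF assms(1,2) geodesic_btw(1)[OF c le] z] geodesic_btw(2)[OF c le] by simp
    then have "z = f (d x z / d x b)" using pos by (simp add: f_def)
    moreover have "d x z / d x b \<in> {0..1}" using le pos by simp
    ultimately show "z \<in> f ` {0..1}" by (rule image_eqI)
  next
    fix z assume "z \<in> f ` {0..1}"
    then show "z \<in> {z. btw T x z b}" using geodesic_btw(1)[OF c] r by (auto simp: f_def)
  qed
  ultimately show ?thesis unfolding nondegenerate_arc_def by blast
qed

lemma nondegenerate_arc_ends:
  assumes "nondegenerate_arc T I"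
  obtains a b where "a \<in> I" "b \<in> I" "a \<noteq> b" "I \<subseteq> mspace T"
proof -
  obtain f where f: "embedding_map (top_of_set {0..1::real}) (mtopology_of T) f" "I = f ` {0..1}"
    using assms unfolding nondegenerate_arc_def by blast
  have "inj_on f {0..1}" "continuous_map (top_of_set {0..1}) (mtopology_of T) f"
    using f(1) unfolding embedding_map_def homeomorphic_eq_everything_map continuous_map_in_subtopology
    by simp_all
  then have "f 0 \<noteq> f 1" "I \<subseteq> mspace T"
    using continuous_map_image_subset_topspace f(2) inj_onD[of f "{0..1}" 0 1] by fastforce+
  then show ?thesis using that[of "f 0" "f 1"] f(2) by auto
qed

locale tree_actions = two_trees T1 T2
  for T1 :: "'a metric" and T2 :: "'b metric" +
  fixes G :: "('g, 'm) monoid_scheme" and \<phi>1 :: "'g \<Rightarrow> 'a \<Rightarrow> 'a" and \<phi>2 :: "'g \<Rightarrow> 'b \<Rightarrow> 'b"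
  assumes act1: "tree_action G T1 \<phi>1" and act2: "tree_action G T2 \<phi>2"
begin

definition act :: "'g \<Rightarrow> 'a \<times> 'b \<Rightarrow> 'a \<times> 'b" where
  "act g p = (\<phi>1 g (fst p), \<phi>2 g (snd p))"

definition invariant :: "('a \<times> 'b) set \<Rightarrow> bool" where
  "invariant X \<longleftrightarrow> (\<forall>g\<in>carrier G. \<forall>p\<in>X. act g p \<in> X)"

lemma fst_act [simp]: "fst (act g p) = \<phi>1 g (fst p)" and snd_act [simp]: "snd (act g p) = \<phi>2 g (snd p)"
  by (simp_all add: act_def)

lemma group_G: "group G"
  using act1 by (simp add: tree_action_def group_action_def group_hom_def)

lemma inv_in: "g \<in> carrier G \<Longrightarrow> inv\<^bsub>G\<^esub> g \<in> carrier G"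
  using group_G by (simp add: group.inv_closed)

lemma act_facts:
  assumes "g \<in> carrier G" "p \<in> P"
  shows "act g p \<in> P" "act (inv\<^bsub>G\<^esub> g) (act g p) = p" "act g (act (inv\<^bsub>G\<^esub> g) p) = p"
    "h \<in> carrier G \<Longrightarrow> act (g \<otimes>\<^bsub>G\<^esub> h) p = act g (act h p)"
  using tree_actionD[OF act1 assms(1)] tree_actionD[OF act2 assms(1)] assms(2)
  by (auto simp: act_def mem_Times_iff)

lemma cbtw_act:
  assumes "g \<in> carrier G" "p \<in> P" "q \<in> P" "r \<in> P"
  shows "cbtw (act g p) (act g r) (act g q) \<longleftrightarrow> cbtw p r q"
  using btw_action[OF act1 assms(1)] btw_action[OF act2 assms(1)] assms(2-)
  by (auto simp: cbtw_def mem_Times_iff)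

lemma sum_dist_act:
  assumes "g \<in> carrier G" "p \<in> P" "q \<in> P"
  shows "sum_dist (act g p) (act g q) = sum_dist p q"
  using tree_actionD(5)[OF act1 assms(1)] tree_actionD(5)[OF act2 assms(1)] assms(2-)
  by (auto simp: sum_dist_def mem_Times_iff)

lemma invariant_quadrant_hull:
  assumes X: "X \<subseteq> P" and inv: "invariant X"
  shows "invariant (quadrant_hull X)"
  unfolding invariant_def
proof (intro ballI)
  fix g z assume g: "g \<in> carrier G" and z: "z \<in> quadrant_hull X"
  have zP: "z \<in> P" using z by (simp add: quadrant_hull_def)
  have "X \<inter> A \<times> B \<noteq> {}" if A: "halfspace T1 A" and B: "halfspace T2 B" and gz: "act g z \<in> A \<times> B" for A B
  proof -
    let ?A = "{v \<in> mspace T1. \<phi>1 g v \<in> A}" and ?B = "{v \<in> mspace T2. \<phi>2 g v \<in> B}"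
    have "halfspace T1 ?A" "halfspace T2 ?B"
      using T1.halfspace_preimage[OF act1 g A] T2.halfspace_preimage[OF act2 g B] by auto
    moreover have "z \<in> ?A \<times> ?B" using gz zP by (auto simp: mem_Times_iff)
    ultimately have "X \<inter> ?A \<times> ?B \<noteq> {}" using z by (simp add: quadrant_hull_def)
    then obtain x where "x \<in> X" "x \<in> ?A \<times> ?B" by blast
    then have "act g x \<in> X \<inter> A \<times> B" using inv g by (auto simp: invariant_def mem_Times_iff)
    then show ?thesis by (metis emptyE)
  qed
  then show "act g z \<in> quadrant_hull X"
    unfolding quadrant_hull_def by (intro CollectI conjI allI impI act_facts(1)[OF g zP])
qed

lemma gap_act:
  assumes X: "X \<subseteq> P" and inv: "invariant X" and g: "g \<in> carrier G" and gp: "gap X p q"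
  shows "gap X (act g p) (act g q)"
  unfolding gap_def
proof (intro conjI ballI impI)
  have pq: "p \<in> X" "q \<in> X" "p \<noteq> q" "p \<in> P" "q \<in> P" using gp X by (auto simp: gap_def)
  show "act g p \<in> X" "act g q \<in> X" using inv g pq by (auto simp: invariant_def)
  show "act g p \<noteq> act g q" using act_facts(2)[OF g pq(4)] act_facts(2)[OF g pq(5)] pq(3) by metis
  fix r assume r: "r \<in> X" "cbtw (act g p) r (act g q)"
  let ?r = "act (inv\<^bsub>G\<^esub> g) r"
  have rP: "r \<in> P" "?r \<in> X" "?r \<in> P" using r X inv inv_in[OF g] by (auto simp: invariant_def)
  have "cbtw p ?r q" using cbtw_act[OF g pq(4,5) rP(3)] act_facts(3)[OF g rP(1)] r(2) by simp
  then have "?r = p \<or> ?r = q" using gp rP(2) by (simp add: gap_def)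
  then show "r = act g p \<or> r = act g q" using act_facts(3)[OF g rP(1)] by auto
qed

lemma invariant_fill_gaps:
  assumes X: "X \<subseteq> P" and inv: "invariant X"
  shows "invariant (fill_gaps X)"
  unfolding invariant_def
proof (intro ballI)
  fix g z assume g: "g \<in> carrier G" and z: "z \<in> fill_gaps X"
  show "act g z \<in> fill_gaps X"
  proof (cases "z \<in> X")
    case True
    then show ?thesis using inv g by (auto simp: invariant_def fill_gaps_def)
  next
    case False
    then obtain p q where pq: "gap X p q" "midpoint_of z p q"
      using z unfolding fill_gaps_def by blast
    have M: "p \<in> P" "q \<in> P" "z \<in> P" using pq X by (auto simp: gap_def midpoint_of_def cbtw_def btw_def mem_Times_iff)
    have "midpoint_of (act g z) (act g p) (act g q)"
      using pq(2) cbtw_act[OF g M] tree_actionD(5)[OF act1 g] tree_actionD(5)[OF act2 g] M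
      by (auto simp: midpoint_of_def mem_Times_iff)
    then show ?thesis using gap_act[OF X inv g pq(1)] unfolding fill_gaps_def by blast
  qed
qed

lemma fill_gaps_subset: "X \<subseteq> P \<Longrightarrow> fill_gaps X \<subseteq> P"
  by (auto simp: fill_gaps_def midpoint_of_def cbtw_def btw_def)

text \<open>A crossing is witnessed by four points, so unions of chains of noncrossing sets are noncrossing
  and Zorn's lemma applies. The hull and the filling of a maximal set are noncrossing and
  invariant again, so they add nothing.\<close>

lemma invariant_noncrossing_completion:
  assumes C: "C \<subseteq> P" "invariant C" "\<not> crosses C"
  obtains X where "C \<subseteq> X" "X \<subseteq> P" "invariant X" "\<not> crosses X" "quadrant_hull X \<subseteq> X" "fill_gaps X \<subseteq> X"
proof -
  define F where "F = {X. C \<subseteq> X \<and> X \<subseteq> P \<and> invariant X \<and> \<not> crosses X}"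
  have "\<exists>X\<in>F. \<forall>Y\<in>F. X \<subseteq> Y \<longrightarrow> Y = X"
  proof (rule subset_Zorn_nonempty)
    show "F \<noteq> {}" using C by (auto simp: F_def)
    fix K assume K: "K \<noteq> {}" "subset.chain F K"
    then have KF: "K \<subseteq> F" by (simp add: subset.chain_def)
    have "\<not> crosses (\<Union>K)"
    proof
      assume "crosses (\<Union>K)"
      then obtain A A' B B' where AB: "opposite T1 A A'" "opposite T2 B B'"
        and ne: "\<Union>K \<inter> A \<times> B \<noteq> {}" "\<Union>K \<inter> A \<times> B' \<noteq> {}" "\<Union>K \<inter> A' \<times> B \<noteq> {}" "\<Union>K \<inter> A' \<times> B' \<noteq> {}"
        by (rule crossesE)
      have pt: "\<exists>p. p \<in> S \<and> p \<in> Q" if "S \<inter> Q \<noteq> {}" for S Q :: "('a \<times> 'b) set"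
        using that by blast
      obtain p where p: "p \<in> \<Union>K" "p \<in> A \<times> B" using pt[OF ne(1)] by (elim exE conjE)
      obtain q where q: "q \<in> \<Union>K" "q \<in> A \<times> B'" using pt[OF ne(2)] by (elim exE conjE)
      obtain r where r: "r \<in> \<Union>K" "r \<in> A' \<times> B" using pt[OF ne(3)] by (elim exE conjE)
      obtain s where s: "s \<in> \<Union>K" "s \<in> A' \<times> B'" using pt[OF ne(4)] by (elim exE conjE)
      have fin: "finite {p, q, r, s}" "{p, q, r, s} \<subseteq> \<Union>K" using p(1) q(1) r(1) s(1) by simp_all
      obtain Y where Y: "Y \<in> K" "{p, q, r, s} \<subseteq> Y"
        using finite_subset_Union_chain[OF fin K] .
      have "Y \<inter> A \<times> B \<noteq> {}" "Y \<inter> A \<times> B' \<noteq> {}" "Y \<inter> A' \<times> B \<noteq> {}" "Y \<inter> A' \<times> B' \<noteq> {}"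
        using Y(2) p(2) q(2) r(2) s(2) by auto
      then have "crosses Y" by (rule crossesI[OF AB])
      then show False using Y(1) KF by (auto simp: F_def)
    qed
    moreover have "C \<subseteq> \<Union>K" using K(1) KF by (auto simp: F_def)
    moreover have "\<Union>K \<subseteq> P" using KF by (force simp: F_def)
    moreover have "invariant (\<Union>K)" using KF unfolding F_def invariant_def by blast
    ultimately show "\<Union>K \<in> F" by (simp add: F_def)
  qed
  then obtain X where X: "X \<in> F" and max: "\<And>Y. Y \<in> F \<Longrightarrow> X \<subseteq> Y \<Longrightarrow> Y = X" by blast
  have XP: "C \<subseteq> X" "X \<subseteq> P" "invariant X" "\<not> crosses X" using X by (auto simp: F_def)
  have "quadrant_hull X \<in> F"
    using XP quadrant_hull_superset[OF XP(2)] invariant_quadrant_hull[OF XP(2,3)] crosses_quadrant_hull[of X]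
    by (auto simp: F_def quadrant_hull_def)
  then have h: "quadrant_hull X \<subseteq> X" using max quadrant_hull_superset[OF XP(2)] by blast
  have sup: "X \<subseteq> fill_gaps X" by (auto simp: fill_gaps_def)
  have "fill_gaps X \<in> F"
    unfolding F_def
    using XP sup fill_gaps_subset[OF XP(2)] invariant_fill_gaps[OF XP(2,3)] crosses_fill_gaps[OF XP(2) h] by blast
  then have "fill_gaps X \<subseteq> X" using max[OF _ sup] by simp
  then show ?thesis using that XP h by blast
qed

end

section \<open>The core\<close>

lemma filterlim_at_top_minus_const:
  fixes f g :: "'a \<Rightarrow> real"
  assumes "filterlim f at_top F" "\<And>k. f k - c \<le> g k"
  shows "filterlim g at_top F"
  unfolding filterlim_at_top
proof
  fix Z
  have "eventually (\<lambda>k. Z + c \<le> f k) F" using assms(1) unfolding filterlim_at_top by blast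
  then show "eventually (\<lambda>k. Z \<le> g k) F"
  proof (rule eventually_mono)
    fix k assume "Z + c \<le> f k"
    then show "Z \<le> g k" using assms(2)[of k] by linarith
  qed
qed

lemma (in rtree) opposite_around_midpoint:
  assumes "a \<in> M" "b \<in> M" "a \<noteq> b"
  obtains A B where "opposite T A B" "a \<in> A" "b \<in> B"
proof -
  have pos: "d a b > 0" using assms mdist_nonneg[of T a b] by (simp add: order_less_le)
  then show ?thesis
    using opposite_four[of a b a b] assms that by (auto simp: mdist_commute)
qed

text \<open>A nondegenerate piece of the segment that separates \<open>{p,q}\<close> from
  \<open>{r,s}\<close>: it starts at the base point \<open>x\<close> of the two directions and
  ends at the projection of \<open>x\<close> to \<open>[p,q]\<close>.\<close>

lemma (in rtree) arc_in_bridge: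
  assumes opp: "opposite T A A'" and p: "p \<in> A" and q: "q \<in> A" and r: "r \<in> A'" and s: "s \<in> A'"
  obtains x b where "x \<in> M" "b \<in> M" "x \<noteq> b"
    "\<And>z u v. btw T x z b \<Longrightarrow> u \<in> {p, q} \<Longrightarrow> v \<in> {r, s} \<Longrightarrow> btw T u z v"
proof -
  obtain x a a' where x: "x \<in> M" "a \<in> M" "a' \<in> M" "a \<noteq> x" "A = side x a" "A' = side x a'"
    using opp by (auto simp: opposite_def directions_eq_sides)
  have M: "p \<in> M" "q \<in> M" "r \<in> M" "s \<in> M"
    using p q r s x by (auto simp: side_def)
  obtain b where b: "btw T x b p" "btw T p b q" "btw T x b q" using median[OF x(1) M(1,2)] .
  have bM: "b \<in> M" by (rule btw_mspace[OF b(1)])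
  have bA: "b \<in> A" by (rule halfspace_convex[OF opposite_halfspace(1)[OF opp] p q b(2)])
  have "x \<noteq> b" using bA x by (auto simp: side_def)
  moreover have "btw T u z v" if z: "btw T x z b" and u: "u \<in> {p, q}" and v: "v \<in> {r, s}" for z u v
  proof -
    have uM: "u \<in> M" "u \<in> A" "v \<in> M" "v \<in> A'" using u v M p q r s by auto
    have "v \<notin> A" using opposite_disjoint[OF opp, of v] uM by blast
    moreover have "A = side x u" using side_eq[of a x u] x uM by simp
    ultimately have uxv: "btw T u x v" using uM by (auto simp: side_def)
    have "btw T x b u" using b u by auto
    then have "btw T x z u" using btw_trans(1)[OF x(1) uM(1) _ z] by blast
    then show ?thesis using btw_trans(1)[OF uM(1,3) uxv] by (simp add: btw_commute[of T x])
  qed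
  ultimately show ?thesis using that x(1) bM by blast
qed

text \<open>The orbits of \<open>p\<close> and \<open>q\<close> stay at constant distance, and an orbit
  point of \<open>p\<close> that is far away is also far from the boundary point of the
  half-space.\<close>

lemma (in rtree) eventually_orbit_in_halfspace:
  assumes act: "tree_action G T \<phi>" and A: "halfspace T A" and p: "p \<in> M" and q: "q \<in> M"
    and \<gamma>: "\<And>k. \<gamma> k \<in> carrier G" "\<And>k. \<phi> (\<gamma> k) p \<in> A"
    and lim: "filterlim (\<lambda>k. d (\<phi> (\<gamma> k) p) p) at_top F"
  shows "eventually (\<lambda>k. \<phi> (\<gamma> k) q \<in> A) F"
proof -
  obtain x u where x: "x \<in> M" "u \<in> M" "u \<noteq> x" "A = side x u" using A by (rule halfspaceE)
  have "eventually (\<lambda>k. d p q + d p x + 1 \<le> d (\<phi> (\<gamma> k) p) p) F"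
    using lim unfolding filterlim_at_top by blast
  then show ?thesis
  proof (rule eventually_mono)
    fix k assume far: "d p q + d p x + 1 \<le> d (\<phi> (\<gamma> k) p) p"
    note f = tree_actionD[OF act \<gamma>(1)[of k]]
    have M: "\<phi> (\<gamma> k) p \<in> M" "\<phi> (\<gamma> k) q \<in> M" using f(2) p q by auto
    have "d (\<phi> (\<gamma> k) p) p \<le> d (\<phi> (\<gamma> k) p) x + d x p" by (intro mdist_triangle M x p)
    moreover have "d (\<phi> (\<gamma> k) p) (\<phi> (\<gamma> k) q) = d p q" using f(5)[OF p q] .
    ultimately have "d (\<phi> (\<gamma> k) p) (\<phi> (\<gamma> k) q) < d (\<phi> (\<gamma> k) p) x"
      using far mdist_commute[of T x p] by linarith
    then show "\<phi> (\<gamma> k) q \<in> A"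
      using side_ball[OF x(2,1) M] \<gamma>(2)[of k] M by (simp add: x(4) side_def)
  qed
qed

context tree_actions
begin

text \<open>The refinement is \<open>X\<close> with the sum metric and the diagonal action. The projections
  are onto because their images are invariant subtrees of minimal trees.\<close>

lemma refinement_of_noncrossing:
  assumes X: "X \<subseteq> P" "X \<noteq> {}" "invariant X" "\<not> crosses X" "quadrant_hull X \<subseteq> X" "fill_gaps X \<subseteq> X"
    and min1: "minimal_action G T1 \<phi>1" and min2: "minimal_action G T2 \<phi>2"
  shows "has_common_refinement TYPE('a \<times> 'b) G T1 \<phi>1 T2 \<phi>2"
proof -
  let ?S = "sum_metric X"
  let ?\<phi> = "\<lambda>g. restrict (act g) X"
  have geoS: "geodesic_space ?S" by (rule geodesic_space_sum_metric[OF X(1,4,5,6)])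
  have tree: "real_tree ?S"
    using rtree_imp_real_tree[OF geoS four_point_sum_metric[OF X(1,4)]] X by simp
  have gX: "act g p \<in> X" if "g \<in> carrier G" "p \<in> X" for g p
    using X(3) that by (auto simp: invariant_def)
  have PX: "p \<in> P" if "p \<in> X" for p using X(1) that by blast
  have bij: "?\<phi> g \<in> Bij X" if g: "g \<in> carrier G" for g
  proof -
    have "bij_betw (act g) X X"
      by (rule bij_betw_byWitness[where f' = "act (inv\<^bsub>G\<^esub> g)"])
        (use gX g inv_in[OF g] act_facts(2,3)[OF g PX] in auto)
    then have "bij_betw (?\<phi> g) X X" by (subst bij_betw_cong[of X _ "act g"]) auto
    then show ?thesis by (simp add: Bij_def)
  qed
  have "group_action G X ?\<phi>"
    unfolding group_action_def group_hom_def group_hom_axioms_def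
  proof (intro conjI group_G group_BijGroup)
    show "?\<phi> \<in> hom G (BijGroup X)"
    proof (rule homI)
      show "?\<phi> g \<in> carrier (BijGroup X)" if "g \<in> carrier G" for g
        using bij[OF that] by (simp add: BijGroup_def)
      show "?\<phi> (g \<otimes>\<^bsub>G\<^esub> h) = ?\<phi> g \<otimes>\<^bsub>BijGroup X\<^esub> ?\<phi> h"
        if g: "g \<in> carrier G" and h: "h \<in> carrier G" for g h
        using bij[OF g] bij[OF h] act_facts(4)[OF g PX h] gX[OF h]
        by (auto simp: BijGroup_def compose_def restrict_def)
    qed
  qed
  then have actS: "tree_action G ?S ?\<phi>"
    using tree sum_dist_act PX X(1) by (auto simp: tree_action_def)
  note align = preserves_alignment_projections[OF X(1) geoS]
  have onto1: "fst ` X = mspace T1"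
  proof (rule ccontr)
    assume ne: "fst ` X \<noteq> mspace T1"
    have "subtree T1 (fst ` X)"
      using T1.continuous_image_subtree[OF geoS, of fst] align(1) X by (auto simp: preserves_alignment_def)
    moreover have "\<phi>1 g ` fst ` X = fst ` X" if g: "g \<in> carrier G" for g
    proof (intro equalityI subsetI)
      fix x assume "x \<in> \<phi>1 g ` fst ` X"
      then obtain p where "p \<in> X" "x = fst (act g p)" by auto
      then show "x \<in> fst ` X" using gX[OF g] by blast
    next
      fix x assume "x \<in> fst ` X"
      then obtain p where p: "p \<in> X" "x = fst p" by auto
      have "x = \<phi>1 g (fst (act (inv\<^bsub>G\<^esub> g) p))"
        using arg_cong[OF act_facts(3)[OF g PX[OF p(1)]], of fst] p(2) by simp
      then show "x \<in> \<phi>1 g ` fst ` X" using gX[OF inv_in[OF g] p(1)] by blast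
    qed
    ultimately show False using min1 ne unfolding minimal_action_def by blast
  qed
  have onto2: "snd ` X = mspace T2"
  proof (rule ccontr)
    assume ne: "snd ` X \<noteq> mspace T2"
    have "subtree T2 (snd ` X)"
      using T2.continuous_image_subtree[OF geoS, of snd] align(2) X by (auto simp: preserves_alignment_def)
    moreover have "\<phi>2 g ` snd ` X = snd ` X" if g: "g \<in> carrier G" for g
    proof (intro equalityI subsetI)
      fix x assume "x \<in> \<phi>2 g ` snd ` X"
      then obtain p where "p \<in> X" "x = snd (act g p)" by auto
      then show "x \<in> snd ` X" using gX[OF g] by blast
    next
      fix x assume "x \<in> snd ` X"
      then obtain p where p: "p \<in> X" "x = snd p" by auto
      have "x = \<phi>2 g (snd (act (inv\<^bsub>G\<^esub> g) p))"
        using arg_cong[OF act_facts(3)[OF g PX[OF p(1)]], of snd] p(2) by simp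
      then show "x \<in> \<phi>2 g ` snd ` X" using gX[OF inv_in[OF g] p(1)] by blast
    qed
    ultimately show False using min2 ne unfolding minimal_action_def by blast
  qed
  have "refinement G ?S ?\<phi> T1 \<phi>1"
    unfolding refinement_def using actS act1 align(1) onto1 X(1)
    by (intro conjI exI[of _ fst]) auto
  moreover have "refinement G ?S ?\<phi> T2 \<phi>2"
    unfolding refinement_def using actS act2 align(2) onto2 X(1)
    by (intro conjI exI[of _ snd]) auto
  ultimately show ?thesis unfolding has_common_refinement_def by blast
qed

lemma mem_core:
  "z \<in> core G T1 \<phi>1 T2 \<phi>2 p1 p2 \<longleftrightarrow>
     z \<in> P \<and> (\<forall>A B. halfspace T1 A \<longrightarrow> halfspace T2 B \<longrightarrow> z \<in> A \<times> B \<longrightarrow>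
       heavy G T1 \<phi>1 T2 \<phi>2 p1 p2 (A \<times> B))"
proof -
  have "Q \<in> quadrants T1 T2 \<longleftrightarrow> (\<exists>A B. halfspace T1 A \<and> halfspace T2 B \<and> Q = A \<times> B)" for Q
    by (auto simp: quadrants_def halfspace_def)
  then have ex: "(\<exists>Q\<in>quadrants T1 T2. z \<in> Q \<and> \<not> H Q) \<longleftrightarrow>
      (\<exists>A B. halfspace T1 A \<and> halfspace T2 B \<and> z \<in> A \<times> B \<and> \<not> H (A \<times> B))" for H
    unfolding Bex_def by metis
  have un: "z \<in> \<Union>{Q \<in> quadrants T1 T2. \<not> H Q} \<longleftrightarrow> (\<exists>Q\<in>quadrants T1 T2. z \<in> Q \<and> \<not> H Q)" for H
    by blast
  show ?thesis
    unfolding core_def Diff_iff un ex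
    by (simp only: not_ex de_Morgan_conj not_not imp_conv_disj)
qed

lemma invariant_core:
  assumes p: "p1 \<in> mspace T1" "p2 \<in> mspace T2"
  shows "invariant (core G T1 \<phi>1 T2 \<phi>2 p1 p2)"
  unfolding invariant_def
proof (intro ballI)
  fix g z assume g: "g \<in> carrier G" and z: "z \<in> core G T1 \<phi>1 T2 \<phi>2 p1 p2"
  have zP: "z \<in> P" using z mem_core by blast
  have far: "mdist T (\<phi> h p) p - mdist T (\<phi> g p) p \<le> mdist T (\<phi> (g \<otimes>\<^bsub>G\<^esub> h) p) p"
    if "tree_action G T \<phi>" "h \<in> carrier G" "p \<in> mspace T" for T :: "'x metric" and \<phi> h p
  proof -
    note f = tree_actionD[OF that(1)]
    have M: "\<phi> h p \<in> mspace T" "\<phi> g p \<in> mspace T" "\<phi> g (\<phi> h p) \<in> mspace T"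
      using f(2) g that by auto
    have "mdist T (\<phi> g (\<phi> h p)) (\<phi> g p) = mdist T (\<phi> h p) p"
      using f(5)[OF g M(1) that(3)] .
    moreover have "mdist T (\<phi> g (\<phi> h p)) (\<phi> g p) \<le> mdist T (\<phi> g (\<phi> h p)) p + mdist T p (\<phi> g p)"
      by (intro mdist_triangle M that)
    ultimately show ?thesis
      using f(6)[OF g that(3) that(2)] mdist_commute[of T p "\<phi> g p"] by simp
  qed
  have "heavy G T1 \<phi>1 T2 \<phi>2 p1 p2 (A \<times> B)"
    if A: "halfspace T1 A" and B: "halfspace T2 B" and gz: "act g z \<in> A \<times> B" for A B
  proof -
    let ?A = "{v \<in> mspace T1. \<phi>1 g v \<in> A}" and ?B = "{v \<in> mspace T2. \<phi>2 g v \<in> B}"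
    have "halfspace T1 ?A" "halfspace T2 ?B"
      using T1.halfspace_preimage[OF act1 g A] T2.halfspace_preimage[OF act2 g B] by auto
    moreover have "z \<in> ?A \<times> ?B" using gz zP by (auto simp: mem_Times_iff)
    ultimately have "heavy G T1 \<phi>1 T2 \<phi>2 p1 p2 (?A \<times> ?B)" using z unfolding mem_core by blast
    then obtain \<gamma> :: "nat \<Rightarrow> 'g" where \<gamma>: "\<And>k. \<gamma> k \<in> carrier G"
      "\<And>k. (\<phi>1 (\<gamma> k) p1, \<phi>2 (\<gamma> k) p2) \<in> ?A \<times> ?B"
      and lim: "filterlim (\<lambda>k. mdist T1 (\<phi>1 (\<gamma> k) p1) p1) at_top sequentially"
        "filterlim (\<lambda>k. mdist T2 (\<phi>2 (\<gamma> k) p2) p2) at_top sequentially"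
      unfolding heavy_def by blast
    have "\<phi>1 (g \<otimes>\<^bsub>G\<^esub> \<gamma> k) p1 \<in> A" "\<phi>2 (g \<otimes>\<^bsub>G\<^esub> \<gamma> k) p2 \<in> B" for k
      using \<gamma>(2)[of k] tree_actionD(6)[OF act1 g p(1) \<gamma>(1)[of k]] tree_actionD(6)[OF act2 g p(2) \<gamma>(1)[of k]]
      by auto
    moreover have "g \<otimes>\<^bsub>G\<^esub> \<gamma> k \<in> carrier G" for k
      using group_G g \<gamma>(1) by (simp add: group.is_monoid monoid.m_closed)
    moreover have "filterlim (\<lambda>k. mdist T1 (\<phi>1 (g \<otimes>\<^bsub>G\<^esub> \<gamma> k) p1) p1) at_top sequentially"
      by (rule filterlim_at_top_minus_const[OF lim(1) far[OF act1 \<gamma>(1) p(1)]])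
    moreover have "filterlim (\<lambda>k. mdist T2 (\<phi>2 (g \<otimes>\<^bsub>G\<^esub> \<gamma> k) p2) p2) at_top sequentially"
      by (rule filterlim_at_top_minus_const[OF lim(2) far[OF act2 \<gamma>(1) p(2)]])
    ultimately show ?thesis
      unfolding heavy_def by (intro exI[of _ "\<lambda>k. g \<otimes>\<^bsub>G\<^esub> \<gamma> k"]) auto
  qed
  then show "act g z \<in> core G T1 \<phi>1 T2 \<phi>2 p1 p2"
    unfolding mem_core by (intro conjI allI impI act_facts(1)[OF g zP])
qed

text \<open>Let \<open>p, q, r, s\<close> be points of the core in the four quadrants of a crossing, and let
  \<open>(z,w)\<close> be a point on the product of the two bridges. A half-space around
  \<open>z\<close> contains both \<open>p\<close> and \<open>q\<close>, or both \<open>r\<close>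
  and \<open>s\<close> (first coordinates); a half-space around \<open>w\<close> contains both
  \<open>p\<close> and \<open>r\<close>, or both \<open>q\<close> and \<open>s\<close> (second
  coordinates). In each case the quadrant contains one of the four points, so it is heavy. Hence
  the core contains a rectangle.\<close>

lemma core_not_crosses:
  assumes one: "one_dimensional T1 T2 (core G T1 \<phi>1 T2 \<phi>2 p1 p2)"
  shows "\<not> crosses (core G T1 \<phi>1 T2 \<phi>2 p1 p2)" (is "\<not> crosses ?C")
proof
  assume "crosses ?C"
  then obtain A A' B B' where AB: "opposite T1 A A'" "opposite T2 B B'"
    and ne: "?C \<inter> A \<times> B \<noteq> {}" "?C \<inter> A \<times> B' \<noteq> {}" "?C \<inter> A' \<times> B \<noteq> {}" "?C \<inter> A' \<times> B' \<noteq> {}"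
    by (rule crossesE)
  obtain p where p: "p \<in> ?C" "fst p \<in> A" "snd p \<in> B" using ne(1) by auto
  obtain q where q: "q \<in> ?C" "fst q \<in> A" "snd q \<in> B'" using ne(2) by auto
  obtain r where r: "r \<in> ?C" "fst r \<in> A'" "snd r \<in> B" using ne(3) by auto
  obtain s where s: "s \<in> ?C" "fst s \<in> A'" "snd s \<in> B'" using ne(4) by auto
  have CP: "?C \<subseteq> P" using mem_core by blast
  note M = coords_in[OF CP p(1)] coords_in[OF CP q(1)] coords_in[OF CP r(1)] coords_in[OF CP s(1)]
  obtain x b where x: "x \<in> mspace T1" "b \<in> mspace T1" "x \<noteq> b"
    and xb: "\<And>z u v. btw T1 x z b \<Longrightarrow> u \<in> {fst p, fst q} \<Longrightarrow> v \<in> {fst r, fst s} \<Longrightarrow> btw T1 u z v"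
    using T1.arc_in_bridge[OF AB(1) p(2) q(2) r(2) s(2)] by blast
  obtain y c where y: "y \<in> mspace T2" "c \<in> mspace T2" "y \<noteq> c"
    and yc: "\<And>z u v. btw T2 y z c \<Longrightarrow> u \<in> {snd p, snd r} \<Longrightarrow> v \<in> {snd q, snd s} \<Longrightarrow> btw T2 u z v"
    using T2.arc_in_bridge[OF AB(2) p(3) r(3) q(3) s(3)] by blast
  have "(z, w) \<in> ?C" if z: "btw T1 x z b" and w: "btw T2 y w c" for z w
    unfolding mem_core
  proof (intro conjI allI impI)
    show "(z, w) \<in> P" using z w by (auto simp: btw_def)
    fix D E assume D: "halfspace T1 D" and E: "halfspace T2 E" and zw: "(z, w) \<in> D \<times> E"
    have zD: "z \<in> D" and wE: "w \<in> E" using zw by auto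
    have "u \<in> D \<or> v \<in> D" if "u \<in> {fst p, fst q}" "v \<in> {fst r, fst s}" for u v
      using T1.halfspace_coconvex[OF D _ _ zD xb[OF z that]] that M by auto
    then have d: "(fst p \<in> D \<and> fst q \<in> D) \<or> (fst r \<in> D \<and> fst s \<in> D)" by auto
    have "u \<in> E \<or> v \<in> E" if "u \<in> {snd p, snd r}" "v \<in> {snd q, snd s}" for u v
      using T2.halfspace_coconvex[OF E _ _ wE yc[OF w that]] that M by auto
    then have "(snd p \<in> E \<and> snd r \<in> E) \<or> (snd q \<in> E \<and> snd s \<in> E)" by auto
    with d have "p \<in> D \<times> E \<or> q \<in> D \<times> E \<or> r \<in> D \<times> E \<or> s \<in> D \<times> E"
      by (auto simp: mem_Times_iff)
    then show "heavy G T1 \<phi>1 T2 \<phi>2 p1 p2 (D \<times> E)"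
      using p(1) q(1) r(1) s(1) D E unfolding mem_core by blast
  qed
  then have "{z. btw T1 x z b} \<times> {w. btw T2 y w c} \<subseteq> ?C" by blast
  then show False
    using one T1.nondegenerate_arc_segment[OF x] T2.nondegenerate_arc_segment[OF y]
    unfolding one_dimensional_def by blast
qed

text \<open>Heaviness is defined with one base point, but orbits stay at bounded distance from each other,
  so every orbit enters a heavy quadrant.\<close>

lemma heavy_point_of_any_orbit:
  assumes hv: "heavy G T1 \<phi>1 T2 \<phi>2 p1 p2 (A \<times> B)" and A: "halfspace T1 A" and B: "halfspace T2 B"
    and p: "p1 \<in> mspace T1" "p2 \<in> mspace T2" and q: "q1 \<in> mspace T1" "q2 \<in> mspace T2"
  obtains g where "g \<in> carrier G" "\<phi>1 g q1 \<in> A" "\<phi>2 g q2 \<in> B"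
proof -
  obtain \<gamma> :: "nat \<Rightarrow> 'g" where \<gamma>: "\<And>k. \<gamma> k \<in> carrier G"
    "\<And>k. (\<phi>1 (\<gamma> k) p1, \<phi>2 (\<gamma> k) p2) \<in> A \<times> B"
    and lim: "filterlim (\<lambda>k. mdist T1 (\<phi>1 (\<gamma> k) p1) p1) at_top sequentially"
      "filterlim (\<lambda>k. mdist T2 (\<phi>2 (\<gamma> k) p2) p2) at_top sequentially"
    using hv unfolding heavy_def by blast
  have "eventually (\<lambda>k. \<phi>1 (\<gamma> k) q1 \<in> A) sequentially"
    by (rule T1.eventually_orbit_in_halfspace[OF act1 A p(1) q(1) \<gamma>(1) _ lim(1)]) (use \<gamma>(2) in auto)
  moreover have "eventually (\<lambda>k. \<phi>2 (\<gamma> k) q2 \<in> B) sequentially"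
    by (rule T2.eventually_orbit_in_halfspace[OF act2 B p(2) q(2) \<gamma>(1) _ lim(2)]) (use \<gamma>(2) in auto)
  ultimately have "eventually (\<lambda>k. \<phi>1 (\<gamma> k) q1 \<in> A \<and> \<phi>2 (\<gamma> k) q2 \<in> B) sequentially"
    by (rule eventually_conj)
  then obtain k where "\<phi>1 (\<gamma> k) q1 \<in> A" "\<phi>2 (\<gamma> k) q2 \<in> B"
    using eventually_happens'[OF sequentially_bot] by blast
  then show ?thesis using that \<gamma>(1) by blast
qed

text \<open>The corners of a rectangle in the core make the four quadrants at its centre heavy, so each of
  them contains the image of a point \<open>ti\<close> of \<open>T\<close>. The segments
  \<open>[t1,t2]\<close> and \<open>[t3,t4]\<close> go to opposite directions of the first tree,
  so they are disjoint, and \<open>[t1,t3]\<close> and \<open>[t2,t4]\<close> go to opposite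
  directions of the second one. But in \<open>T\<close> one of these pairs meets.\<close>

lemma one_dimensional_of_refinement:
  fixes T :: "'c metric"
  assumes p: "p1 \<in> mspace T1" "p2 \<in> mspace T2"
    and ref1: "refinement G T \<phi> T1 \<phi>1" and ref2: "refinement G T \<phi> T2 \<phi>2"
  shows "one_dimensional T1 T2 (core G T1 \<phi>1 T2 \<phi>2 p1 p2)" (is "one_dimensional T1 T2 ?C")
  unfolding one_dimensional_def
proof
  assume "\<exists>I1 I2. nondegenerate_arc T1 I1 \<and> nondegenerate_arc T2 I2 \<and> I1 \<times> I2 \<subseteq> ?C"
  then obtain I1 I2 where I: "nondegenerate_arc T1 I1" "nondegenerate_arc T2 I2" "I1 \<times> I2 \<subseteq> ?C" by blast
  have actT: "tree_action G T \<phi>" using ref1 by (simp add: refinement_def)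
  then have "real_tree T" by (simp add: tree_action_def)
  then interpret T: rtree T by (rule real_tree_imp_rtree)
  obtain f1 where f1: "preserves_alignment T T1 f1" "f1 ` mspace T = mspace T1"
    "\<And>g x. g \<in> carrier G \<Longrightarrow> x \<in> mspace T \<Longrightarrow> f1 (\<phi> g x) = \<phi>1 g (f1 x)"
    using ref1 unfolding refinement_def by blast
  obtain f2 where f2: "preserves_alignment T T2 f2" "f2 ` mspace T = mspace T2"
    "\<And>g x. g \<in> carrier G \<Longrightarrow> x \<in> mspace T \<Longrightarrow> f2 (\<phi> g x) = \<phi>2 g (f2 x)"
    using ref2 unfolding refinement_def by blast
  obtain t0 where t0: "t0 \<in> mspace T" using \<open>real_tree T\<close> by (auto simp: real_tree_def)
  have ft: "f1 t0 \<in> mspace T1" "f2 t0 \<in> mspace T2" using f1(2) f2(2) t0 by auto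
  obtain a b where a: "a \<in> I1" "b \<in> I1" "a \<noteq> b" "I1 \<subseteq> mspace T1"
    using nondegenerate_arc_ends[OF I(1)] .
  obtain c e where c: "c \<in> I2" "e \<in> I2" "c \<noteq> e" "I2 \<subseteq> mspace T2"
    using nondegenerate_arc_ends[OF I(2)] .
  obtain A A' where A: "opposite T1 A A'" "a \<in> A" "b \<in> A'"
    using T1.opposite_around_midpoint[of a b] a by blast
  obtain B B' where B: "opposite T2 B B'" "c \<in> B" "e \<in> B'"
    using T2.opposite_around_midpoint[of c e] c by blast
  have pt: "\<exists>t\<in>mspace T. f1 t \<in> D \<and> f2 t \<in> E"
    if D: "halfspace T1 D" and E: "halfspace T2 E" and "x \<in> I1" "y \<in> I2" "x \<in> D" "y \<in> E" for D E x y
  proof -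
    have "(x, y) \<in> ?C" "(x, y) \<in> D \<times> E" using I(3) that by auto
    then have "heavy G T1 \<phi>1 T2 \<phi>2 p1 p2 (D \<times> E)" using D E unfolding mem_core by blast
    then obtain g where g: "g \<in> carrier G" "\<phi>1 g (f1 t0) \<in> D" "\<phi>2 g (f2 t0) \<in> E"
      using heavy_point_of_any_orbit[OF _ D E p ft] by blast
    then show ?thesis
      using f1(3)[OF g(1) t0] f2(3)[OF g(1) t0] tree_actionD(2)[OF actT g(1) t0]
      by (intro bexI[of _ "\<phi> g t0"]) simp_all
  qed
  note H = opposite_halfspace[OF A(1)] opposite_halfspace[OF B(1)]
  obtain t1 where t1: "t1 \<in> mspace T" "f1 t1 \<in> A" "f2 t1 \<in> B" using pt[OF H(1,3) a(1) c(1) A(2) B(2)] by blast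
  obtain t2 where t2: "t2 \<in> mspace T" "f1 t2 \<in> A" "f2 t2 \<in> B'" using pt[OF H(1,4) a(1) c(2) A(2) B(3)] by blast
  obtain t3 where t3: "t3 \<in> mspace T" "f1 t3 \<in> A'" "f2 t3 \<in> B" using pt[OF H(2,3) a(2) c(1) A(3) B(2)] by blast
  obtain t4 where t4: "t4 \<in> mspace T" "f1 t4 \<in> A'" "f2 t4 \<in> B'" using pt[OF H(2,4) a(2) c(2) A(3) B(3)] by blast
  have al1: "btw T1 (f1 u) (f1 m) (f1 v)" if "u \<in> mspace T" "v \<in> mspace T" "btw T u m v" for u m v
    using f1(1) that segment_eq_btw[OF T.geo that(1,2)] segment_eq_btw[OF T1.geo, of "f1 u" "f1 v"] f1(2)
      btw_mspace[OF that(3)] unfolding preserves_alignment_def by blast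
  have al2: "btw T2 (f2 u) (f2 m) (f2 v)" if "u \<in> mspace T" "v \<in> mspace T" "btw T u m v" for u m v
    using f2(1) that segment_eq_btw[OF T.geo that(1,2)] segment_eq_btw[OF T2.geo, of "f2 u" "f2 v"] f2(2)
      btw_mspace[OF that(3)] unfolding preserves_alignment_def by blast
  from T.four_points_segments_meet[OF t1(1) t2(1) t3(1) t4(1)] show False
  proof (elim disjE exE conjE)
    fix m assume m: "btw T t1 m t2" "btw T t3 m t4"
    have "f1 m \<in> A" by (rule T1.halfspace_convex[OF H(1) t1(2) t2(2) al1[OF t1(1) t2(1) m(1)]])
    moreover have "f1 m \<in> A'" by (rule T1.halfspace_convex[OF H(2) t3(2) t4(2) al1[OF t3(1) t4(1) m(2)]])
    ultimately show False using T1.opposite_disjoint[OF A(1)] by blast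
  next
    fix m assume m: "btw T t1 m t3" "btw T t2 m t4"
    have "f2 m \<in> B" by (rule T2.halfspace_convex[OF H(3) t1(3) t3(3) al2[OF t1(1) t3(1) m(1)]])
    moreover have "f2 m \<in> B'" by (rule T2.halfspace_convex[OF H(4) t2(3) t4(3) al2[OF t2(1) t4(1) m(2)]])
    ultimately show False using T2.opposite_disjoint[OF B(1)] by blast
  qed
qed

end

theorem theorem6p1:
  fixes G :: "('g, 'm) monoid_scheme"
    and T1 :: "'a metric" and \<phi>1 :: "'g \<Rightarrow> 'a \<Rightarrow> 'a"
    and T2 :: "'b metric" and \<phi>2 :: "'g \<Rightarrow> 'b \<Rightarrow> 'b"
    and p1 :: 'a and p2 :: 'b
  assumes "finitely_generated G"
    and "minimal_action G T1 \<phi>1"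
    and "minimal_action G T2 \<phi>2"
    and "p1 \<in> mspace T1" and "p2 \<in> mspace T2"
    and "core G T1 \<phi>1 T2 \<phi>2 p1 p2 \<noteq> {}"
  shows "(has_common_refinement TYPE('a \<times> 'b) G T1 \<phi>1 T2 \<phi>2 \<longleftrightarrow>
            one_dimensional T1 T2 (core G T1 \<phi>1 T2 \<phi>2 p1 p2)) \<and>
         (has_common_refinement TYPE('c) G T1 \<phi>1 T2 \<phi>2 \<longrightarrow>
            one_dimensional T1 T2 (core G T1 \<phi>1 T2 \<phi>2 p1 p2))"
proof -
  let ?C = "core G T1 \<phi>1 T2 \<phi>2 p1 p2"
  have act: "tree_action G T1 \<phi>1" "tree_action G T2 \<phi>2"
    using assms(2,3) by (simp_all add: minimal_action_def)
  then have "real_tree T1" "real_tree T2" by (simp_all add: tree_action_def)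
  then have "rtree T1" "rtree T2" by (auto intro: real_tree_imp_rtree)
  then interpret tree_actions T1 T2 G \<phi>1 \<phi>2
    using act by (simp add: tree_actions_def two_trees_def tree_actions_axioms_def)
  have "has_common_refinement TYPE('a \<times> 'b) G T1 \<phi>1 T2 \<phi>2" if one: "one_dimensional T1 T2 ?C"
  proof -
    have "?C \<subseteq> P" using mem_core by blast
    then obtain X where X: "?C \<subseteq> X" "X \<subseteq> P" "invariant X" "\<not> crosses X"
      "quadrant_hull X \<subseteq> X" "fill_gaps X \<subseteq> X"
      using invariant_noncrossing_completion invariant_core[OF assms(4,5)] core_not_crosses[OF one] by blast
    have "X \<noteq> {}" using X(1) assms(6) by blast
    then show ?thesis using refinement_of_noncrossing[OF X(2) _ X(3-6) assms(2,3)] by blast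
  qed
  moreover have "one_dimensional T1 T2 ?C" if "has_common_refinement TYPE('a \<times> 'b) G T1 \<phi>1 T2 \<phi>2"
    using that one_dimensional_of_refinement[OF assms(4,5)] unfolding has_common_refinement_def by blast
  moreover have "one_dimensional T1 T2 ?C" if "has_common_refinement TYPE('c) G T1 \<phi>1 T2 \<phi>2"
    using that one_dimensional_of_refinement[OF assms(4,5)] unfolding has_common_refinement_def by blast
  ultimately show ?thesis by blast
qed

end
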